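(* Assume $N_R<N$ and $P_B^\perp\Omega P_B^\perp\neq0$, let $\rho_{\min}$ be the smallest positive eigenvalue of $P_B^\perp\Omega P_B^\perp$, and let $\beta>c^{-1}(\rho_{\min}/2)$. Then $$\sigma\big(A(\beta)|_{H_{\ell\ell,0}(\beta)}\big)=\{\zeta\in\sigma(A(\beta)):0\le-\operatorname{Im}\zeta\le c(\beta)\text{ and }|\operatorname{Re}\zeta|\le c(\beta)\},$$ $$\sigma\big(A(\beta)|_{H_{\ell\ell,1}(\beta)}\big)=\{\zeta\in\sigma(A(\beta)):0\le-\operatorname{Im}\zeta\le c(\beta)\text{ and }|\operatorname{Re}\zeta|\ge\rho_{\min}-c(\beta)\},$$ where $\rho_{\min}-c(\beta)>\max\{c(\beta),\rho_{\min}/2\}$, $\rho_{\min}/2\le\omega_{\max}/2$, and $c(\beta)\searrow0$ as $\beta\to\infty$. Moreover, $$\min_{\zeta\in\sigma(A(\beta)|_{H_{\ell\ell,1}(\beta)})}Q_\zeta\ge\frac12\frac{\rho_{\min}-c(\beta)}{c(\beta)}>\frac14\frac{\rho_{\min}}{c(\beta)}\ge\frac12 .$$ In particular, $\operatorname{Re}\zeta\ne0$ for every $\zeta\in\sigma\big(A(\beta)|_{H_{\ell\ell,1}(\beta)}\big)$.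
   Context: Setting. $N\ge 1$; $\alpha,\eta,\theta,R$ are real $N\times N$ matrices with $\alpha^{\mathrm T}=\alpha>0$, $\eta^{\mathrm T}=\eta\ge0$, $\theta^{\mathrm T}=-\theta$, $R^{\mathrm T}=R\ge0$, and $N_R=\operatorname{rank}R>0$; $\beta\ge0$. $\sqrt{\cdot}$ denotes the positive semidefinite square root. On $H=\mathbb C^{2N}=\mathbb C^N\oplus\mathbb C^N$ set $$\Omega=\begin{bmatrix}-2\mathrm i\sqrt\alpha^{-1}\theta\sqrt\alpha^{-1} & -\mathrm i\Phi^{\mathrm T}\\ \mathrm i\Phi&0\end{bmatrix},\quad \Phi=\sqrt\eta\sqrt\alpha^{-1},\quad B=\begin{bmatrix}\sqrt\alpha^{-1}R\sqrt\alpha^{-1}&0\\0&0\end{bmatrix},\quad A(\beta)=\Omega-\mathrm i\beta B .$$ $\Omega$ is Hermitian, $B\ge0$, $\operatorname{rank}B=N_R$; all eigenvalues $\zeta$ of $A(\beta)$ satisfy $\operatorname{Im}\zeta\le0$. $P_B^\perp$ is the orthogonal projection onto $\operatorname{Ker}B$ (the spectrum of $P_B^\perp\Omega P_B^\perp$ is real and symmetric about $0$). $\omega_{\max}$ is the largest eigenvalue of $\Omega$ ($=\|\Omega\|$); $b_{\min}$ is the smallest nonzero eigenvalue of $B$ (equivalently of $\alpha^{-1}R$). The decreasing function $c$ and its inverse are $$c(\beta)=\frac{2\omega_{\max}^2}{b_{\min}}\Big[\beta-\frac{2\omega_{\max}}{b_{\min}}\Big]^{-1}\ \Big(\beta>\frac{2\omega_{\max}}{b_{\min}}\Big),\qquad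 c^{-1}(y)=\frac{2\omega_{\max}^2}{b_{\min}}y^{-1}+\frac{2\omega_{\max}}{b_{\min}}\ (y>0).$$ The quality factor is $Q_\zeta=\frac12\frac{|\operatorname{Re}\zeta|}{-\operatorname{Im}\zeta}$, with $Q_\zeta=+\infty$ if $\operatorname{Im}\zeta=0\neq\operatorname{Re}\zeta$ and $Q_0=0$. Subspaces: for $\beta>c^{-1}(\rho_{\min}/2)$, $H_{\ell\ell,0}(\beta)$ is the sum of the generalized eigenspaces of $A(\beta)$ for its eigenvalues in the disc $\{|\zeta|\le c(\beta)\}$, and $H_{\ell\ell,1}(\beta)$ is the sum of the generalized eigenspaces of $A(\beta)$ for its eigenvalues in $\bigcup_{0\ne\rho\in\sigma(P_B^\perp\Omega P_B^\perp)}\{|\zeta-\rho|\le c(\beta)\}$. *)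

theory Defs
  imports "HOL-Analysis.Analysis" "HOL-Library.Extended_Real"
begin

section \<open>Real positive (semi)definite matrices and the square root\<close>

definition pos_semidef :: "real^'n^'n \<Rightarrow> bool" where
  "pos_semidef M \<longleftrightarrow> (\<forall>x. 0 \<le> x \<bullet> (M *v x))"

definition pos_def :: "real^'n^'n \<Rightarrow> bool" where
  "pos_def M \<longleftrightarrow> (\<forall>x. x \<noteq> 0 \<longrightarrow> 0 < x \<bullet> (M *v x))"

text \<open>Well defined only for symmetric positive semidefinite arguments.\<close>

definition msqrt :: "real^'n^'n \<Rightarrow> real^'n^'n" where
  "msqrt M = (THE S. transpose S = S \<and> pos_semidef S \<and> S ** S = M)"


section \<open>Spectra and generalized eigenspaces\<close>

text \<open>Set of eigenvalues of the restriction of a matrix to an invariant subspace;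
  it is empty for the zero subspace.\<close>

definition spec_on :: "complex^'k^'k \<Rightarrow> (complex^'k) set \<Rightarrow> complex set" where
  "spec_on M V = {\<zeta>. \<exists>x\<in>V. x \<noteq> 0 \<and> M *v x = \<zeta> *s x}"

definition spec :: "complex^'k^'k \<Rightarrow> complex set" where
  "spec M = spec_on M UNIV"

text \<open>For a Hermitian matrix these are all the eigenvalues.\<close>

definition real_spec :: "complex^'k^'k \<Rightarrow> real set" where
  "real_spec M = {r. complex_of_real r \<in> spec M}"

definition gen_eigenspace :: "complex^'k^'k \<Rightarrow> complex \<Rightarrow> (complex^'k) set" where
  "gen_eigenspace M \<zeta> = {x. \<exists>m. ((\<lambda>v. M *v v - \<zeta> *s v) ^^ m) x = 0}"

text \<open>The span of the union is the sum of the generalized eigenspaces.\<close>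

definition sum_gen_eigenspaces :: "complex^'k^'k \<Rightarrow> complex set \<Rightarrow> (complex^'k) set" where
  "sum_gen_eigenspaces M Z = vec.span (\<Union>\<zeta>\<in>spec M \<inter> Z. gen_eigenspace M \<zeta>)"


section \<open>Orthogonal projections for the Hermitian inner product\<close>

definition cdot :: "complex^'k \<Rightarrow> complex^'k \<Rightarrow> complex" where
  "cdot x y = (\<Sum>i\<in>UNIV. cnj (x $ i) * y $ i)"

definition ortho_proj :: "(complex^'k) set \<Rightarrow> complex^'k^'k" where
  "ortho_proj S = (THE P. \<forall>x. P *v x \<in> S \<and> (\<forall>y\<in>S. cdot y (x - P *v x) = 0))"

definition mat_ker :: "complex^'k^'k \<Rightarrow> (complex^'k) set" where
  "mat_ker M = {x. M *v x = 0}"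


section \<open>The system operator\<close>

text \<open>The space \<open>\<complex>\<^sup>N \<oplus> \<complex>\<^sup>N\<close> is indexed by the disjoint sum of the index type with itself.\<close>

definition block_matrix ::
    "'a^'n^'n \<Rightarrow> 'a^'n^'n \<Rightarrow> 'a^'n^'n \<Rightarrow> 'a^'n^'n \<Rightarrow> 'a^('n + 'n)^('n + 'n)" where
  "block_matrix M11 M12 M21 M22 = (\<chi> i j.
     (case i of
        Inl k \<Rightarrow> (case j of Inl l \<Rightarrow> M11 $ k $ l | Inr l \<Rightarrow> M12 $ k $ l)
      | Inr k \<Rightarrow> (case j of Inl l \<Rightarrow> M21 $ k $ l | Inr l \<Rightarrow> M22 $ k $ l)))"

definition cmult :: "complex \<Rightarrow> complex^'n^'m \<Rightarrow> complex^'n^'m" where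
  "cmult z M = map_matrix (\<lambda>w. z * w) M"

definition complexify :: "real^'n^'m \<Rightarrow> complex^'n^'m" where
  "complexify M = map_matrix complex_of_real M"

definition Phi_matrix :: "real^'n^'n \<Rightarrow> real^'n^'n \<Rightarrow> real^'n^'n" where
  "Phi_matrix \<alpha> \<eta> = msqrt \<eta> ** matrix_inv (msqrt \<alpha>)"

definition Omega_matrix ::
    "real^'n^'n \<Rightarrow> real^'n^'n \<Rightarrow> real^'n^'n \<Rightarrow> complex^('n + 'n)^('n + 'n)" where
  "Omega_matrix \<alpha> \<eta> \<theta> = block_matrix
     (cmult (- 2 * \<i>) (complexify (matrix_inv (msqrt \<alpha>) ** \<theta> ** matrix_inv (msqrt \<alpha>))))
     (cmult (- \<i>) (complexify (transpose (Phi_matrix \<alpha> \<eta>))))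
     (cmult \<i> (complexify (Phi_matrix \<alpha> \<eta>)))
     0"

definition B_matrix :: "real^'n^'n \<Rightarrow> real^'n^'n \<Rightarrow> complex^('n + 'n)^('n + 'n)" where
  "B_matrix \<alpha> R = block_matrix
     (complexify (matrix_inv (msqrt \<alpha>) ** R ** matrix_inv (msqrt \<alpha>))) 0 0 0"

definition A_matrix :: "complex^'k^'k \<Rightarrow> complex^'k^'k \<Rightarrow> real \<Rightarrow> complex^'k^'k" where
  "A_matrix \<Omega> B \<beta> = \<Omega> - cmult (\<i> * complex_of_real \<beta>) B"


section \<open>Spectral parameters\<close>

definition omega_max :: "complex^'k^'k \<Rightarrow> real" where
  "omega_max \<Omega> = Max (real_spec \<Omega>)"

definition b_min :: "complex^'k^'k \<Rightarrow> real" where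
  "b_min B = Min (real_spec B - {0})"

definition compressed_Omega :: "complex^'k^'k \<Rightarrow> complex^'k^'k \<Rightarrow> complex^'k^'k" where
  "compressed_Omega \<Omega> B = ortho_proj (mat_ker B) ** \<Omega> ** ortho_proj (mat_ker B)"

definition rho_min :: "complex^'k^'k \<Rightarrow> complex^'k^'k \<Rightarrow> real" where
  "rho_min \<Omega> B = Min {\<rho> \<in> real_spec (compressed_Omega \<Omega> B). 0 < \<rho>}"

text \<open>Meaningful only for \<open>\<beta> > 2 * omega_max \<Omega> / b_min B\<close>.\<close>

definition c_fun :: "complex^'k^'k \<Rightarrow> complex^'k^'k \<Rightarrow> real \<Rightarrow> real" where
  "c_fun \<Omega> B \<beta> =
     2 * (omega_max \<Omega>)\<^sup>2 / b_min B * inverse (\<beta> - 2 * omega_max \<Omega> / b_min B)"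

text \<open>Meaningful only for \<open>y > 0\<close>.\<close>

definition c_inv :: "complex^'k^'k \<Rightarrow> complex^'k^'k \<Rightarrow> real \<Rightarrow> real" where
  "c_inv \<Omega> B y = 2 * (omega_max \<Omega>)\<^sup>2 / b_min B * inverse y + 2 * omega_max \<Omega> / b_min B"

definition H_ll0 :: "complex^'k^'k \<Rightarrow> complex^'k^'k \<Rightarrow> real \<Rightarrow> (complex^'k) set" where
  "H_ll0 \<Omega> B \<beta> = sum_gen_eigenspaces (A_matrix \<Omega> B \<beta>) {\<zeta>. cmod \<zeta> \<le> c_fun \<Omega> B \<beta>}"

definition H_ll1 :: "complex^'k^'k \<Rightarrow> complex^'k^'k \<Rightarrow> real \<Rightarrow> (complex^'k) set" where
  "H_ll1 \<Omega> B \<beta> = sum_gen_eigenspaces (A_matrix \<Omega> B \<beta>)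
     (\<Union>\<rho>\<in>spec (compressed_Omega \<Omega> B) - {0}. {\<zeta>. cmod (\<zeta> - \<rho>) \<le> c_fun \<Omega> B \<beta>})"

text \<open>The value for \<open>Im \<zeta> > 0\<close> is irrelevant: the matrices at hand have no such eigenvalues.\<close>

definition quality_factor :: "complex \<Rightarrow> ereal" where
  "quality_factor \<zeta> =
     (if \<zeta> = 0 then 0
      else if Im \<zeta> = 0 then \<infinity>
      else ereal (1 / 2 * (\<bar>Re \<zeta>\<bar> / (- Im \<zeta>))))"

end

theory Submission
  imports Defs "HOL-Complex_Analysis.Great_Picard"
begin

text \<open>Let \<open>P\<close> be the orthogonal projection onto \<open>Ker B\<close> and \<open>C = P \<Omega> P\<close>. An eigenvector of
  \<open>A(\<beta>)\<close> for \<open>\<zeta>\<close> splits as \<open>u + v\<close> with \<open>u\<close> in \<open>Ker B\<close> and \<open>v\<close> orthogonal to it. The imaginary part of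
  the eigenvalue equation paired with \<open>v\<close> gives \<open>(\<beta> b - \<bar>Im \<zeta>\<bar>) \<parallel>v\<parallel> \<le> \<omega> \<parallel>u\<parallel>\<close>, where \<open>\<omega> = \<parallel>\<Omega>\<parallel>\<close>, and the
  component in \<open>Ker B\<close> gives \<open>dist(\<zeta>, \<sigma>(C)) \<parallel>u\<parallel> \<le> \<omega> \<parallel>v\<parallel>\<close>. Hence every eigenvalue with
  \<open>- Im \<zeta> \<le> \<beta> b / 2 + \<omega>\<close> lies within \<open>c(\<beta>)\<close> of \<open>\<sigma>(C)\<close>, and as \<open>c(\<beta>) < \<rho>\<^sub>m\<^sub>i\<^sub>n / 2\<close> the disc about \<open>0\<close> is
  separated from the others by the real part. The same estimate holds when the coupling
  between \<open>Ker B\<close> and its complement is scaled by \<open>t \<in> [0, 1]\<close>, so by Hurwitz's theorem the eigenvalue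
  \<open>\<rho>\<^sub>m\<^sub>i\<^sub>n\<close> of the decoupled operator persists in the discs about nonzero points up to \<open>t = 1\<close>.\<close>

section \<open>Self-adjoint operators\<close>

definition self_adjoint :: "('a::euclidean_space \<Rightarrow> 'a) \<Rightarrow> bool" where
  "self_adjoint f \<longleftrightarrow> linear f \<and> (\<forall>x y. f x \<bullet> y = x \<bullet> f y)"

lemma nonneg_quadratic_imp_linear_coeff_0:
  fixes p q :: real
  assumes "\<And>s. 0 \<le> 2 * s * p + s\<^sup>2 * q"
  shows "p = 0"
proof (rule ccontr)
  assume p: "p \<noteq> 0"
  \<comment> \<open>For \<open>s = - p / k\<close> the expression equals
    \<open>(p / k)\<^sup>2 * (q - 2 * k)\<close>, which is negative once \<open>k > 0\<close> and
    \<open>q < k\<close>.\<close>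
  define k where "k = \<bar>q\<bar> + 1"
  have k: "k > 0" "q < k" by (auto simp: k_def)
  have "0 \<le> 2 * (- p / k) * p + (- p / k)\<^sup>2 * q" by (rule assms)
  also have "\<dots> = (p / k)\<^sup>2 * (q - 2 * k)"
    using k(1) by (simp add: power2_eq_square field_simps)
  finally have "0 \<le> (p / k)\<^sup>2 * (q - 2 * k)" .
  moreover have "(p / k)\<^sup>2 > 0" using p k by simp
  ultimately show False using k by (simp add: zero_le_mult_iff)
qed

text \<open>The nonnegative form \<open>y \<bullet> f y\<close> is minimal at \<open>x\<close>, so
  its derivative in the direction \<open>f x\<close>, which is twice the square of
  \<open>norm (f x)\<close>, vanishes.\<close>

lemma self_adjoint_nonneg_kernel:
  assumes f: "self_adjoint f" and pos: "\<And>y. 0 \<le> y \<bullet> f y" and x: "x \<bullet> f x = 0"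
  shows "f x = 0"
proof -
  have lin: "linear f" and sym: "\<And>x y. f x \<bullet> y = x \<bullet> f y"
    using f by (auto simp: self_adjoint_def)
  have "f x \<bullet> f x = 0"
  proof (rule nonneg_quadratic_imp_linear_coeff_0)
    fix s :: real
    have "0 \<le> (x + s *\<^sub>R f x) \<bullet> f (x + s *\<^sub>R f x)" by (rule pos)
    also have "\<dots> = 2 * s * (f x \<bullet> f x) + s\<^sup>2 * (f x \<bullet> f (f x))"
      using x sym[of x "f x"]
      by (simp add: linear_add[OF lin] linear_cmul[OF lin] inner_add_left inner_add_right
          power2_eq_square distrib_left)
    finally show "0 \<le> 2 * s * (f x \<bullet> f x) + s\<^sup>2 * (f x \<bullet> f (f x))" .
  qed
  then show ?thesis by simp
qed

text \<open>By compactness the quadratic form attains a minimum \<open>l\<close> on the unit sphere.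
  The form of \<open>f - l\<close> is then nonnegative and vanishes at the minimizer, so the
  minimizer lies in the kernel of \<open>f - l\<close>.\<close>

lemma self_adjoint_least_eigenvalue:
  fixes f :: "'a::euclidean_space \<Rightarrow> 'a"
  assumes f: "self_adjoint f"
  obtains l x where "x \<noteq> 0" "f x = l *\<^sub>R x" "\<And>y. l * (norm y)\<^sup>2 \<le> y \<bullet> f y"
proof -
  have lin: "linear f" and sym: "\<And>x y. f x \<bullet> y = x \<bullet> f y"
    using f by (auto simp: self_adjoint_def)
  let ?S = "sphere 0 1 :: 'a set"
  have "compact ?S" "?S \<noteq> {}" by auto
  moreover have "continuous_on ?S (\<lambda>y. y \<bullet> f y)"
    by (intro continuous_intros linear_continuous_on linear_conv_bounded_linear[THEN iffD1] lin)
  ultimately obtain x where x: "x \<in> ?S" "\<And>y. y \<in> ?S \<Longrightarrow> x \<bullet> f x \<le> y \<bullet> f y"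
    using continuous_attains_inf[of ?S "\<lambda>y. y \<bullet> f y"] by blast
  define l where "l = x \<bullet> f x"
  have bd: "l * (norm y)\<^sup>2 \<le> y \<bullet> f y" for y
  proof (cases "y = 0")
    case False
    let ?z = "(1 / norm y) *\<^sub>R y"
    have "l \<le> ?z \<bullet> f ?z" unfolding l_def by (rule x(2)) (use False in simp)
    also have "\<dots> = (y \<bullet> f y) / (norm y)\<^sup>2"
      by (simp add: linear_cmul[OF lin] power2_eq_square)
    finally show ?thesis using False by (simp add: field_simps)
  qed (simp add: linear_0[OF lin])
  have "f x - l *\<^sub>R x = 0"
  proof (rule self_adjoint_nonneg_kernel[where f = "\<lambda>y. f y - l *\<^sub>R y"])
    show "self_adjoint (\<lambda>y. f y - l *\<^sub>R y)"
      unfolding self_adjoint_def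
      by (auto intro!: linear_compose_sub lin linear_scale_self simp: inner_diff sym)
    show "0 \<le> y \<bullet> (f y - l *\<^sub>R y)" for y
      using bd[of y] by (simp add: inner_diff_right power2_norm_eq_inner)
    show "x \<bullet> (f x - l *\<^sub>R x) = 0"
      using x(1) by (simp add: inner_diff_right l_def flip: power2_norm_eq_inner)
  qed
  moreover have "x \<noteq> 0" using x(1) by auto
  ultimately show thesis using that bd by simp
qed

text \<open>Factor \<open>f\<^sup>2 - s\<^sup>2\<close> as \<open>(f - s) (f + s)\<close>: either
  \<open>f + s\<close> kills \<open>x\<close>, or \<open>f x + s x\<close> is an eigenvector for
  \<open>s\<close>.\<close>

lemma eigenvalue_of_square:
  fixes f :: "'a::real_vector \<Rightarrow> 'a"
  assumes lin: "linear f" and x: "x \<noteq> 0" "f (f x) = s\<^sup>2 *\<^sub>R x"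
  obtains l y where "y \<noteq> 0" "f y = l *\<^sub>R y" "\<bar>l\<bar> = \<bar>s\<bar>"
proof (cases "f x + s *\<^sub>R x = 0")
  case True
  then have "f x = (- s) *\<^sub>R x" by (simp add: add_eq_0_iff)
  then show thesis using that x by fastforce
next
  case False
  have "f (f x + s *\<^sub>R x) = s *\<^sub>R (f x + s *\<^sub>R x)"
    by (simp add: linear_add[OF lin] linear_cmul[OF lin] x power2_eq_square algebra_simps)
  then show thesis using that False by blast
qed

lemma self_adjoint_square: "self_adjoint f \<Longrightarrow> self_adjoint (\<lambda>x. f (f x))"
  unfolding self_adjoint_def using linear_compose[of f f] by (simp add: o_def)

lemma self_adjoint_uminus: "self_adjoint f \<Longrightarrow> self_adjoint (\<lambda>x. - f x)"
  unfolding self_adjoint_def using linear_compose_neg[of f] by simp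

text \<open>The form of the square of \<open>f\<close> is the squared norm of \<open>f y\<close>, so
  its least eigenvalue is the optimal constant; a root of it up to sign is an eigenvalue of
  \<open>f\<close>.\<close>

lemma self_adjoint_smallest_modulus:
  fixes f :: "'a::euclidean_space \<Rightarrow> 'a"
  assumes f: "self_adjoint f"
  obtains l x where "x \<noteq> 0" "f x = l *\<^sub>R x" "\<And>y. \<bar>l\<bar> * norm y \<le> norm (f y)"
proof -
  have lin: "linear f" and sym: "\<And>x y. f x \<bullet> y = x \<bullet> f y"
    using f by (auto simp: self_adjoint_def)
  obtain m x where x: "x \<noteq> 0" "f (f x) = m *\<^sub>R x" and m: "\<And>y. m * (norm y)\<^sup>2 \<le> y \<bullet> f (f y)"
    using self_adjoint_least_eigenvalue[OF self_adjoint_square[OF f]] by metis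
  have "m * (norm x)\<^sup>2 = (norm (f x))\<^sup>2"
    using x sym[of x "f x"] by (simp add: power2_norm_eq_inner)
  then have m0: "m \<ge> 0"
    using x(1) by (metis mult_less_0_iff not_less zero_less_norm_iff zero_less_power zero_le_power2)
  then obtain l y where ly: "y \<noteq> 0" "f y = l *\<^sub>R y" "\<bar>l\<bar> = \<bar>sqrt m\<bar>"
    using eigenvalue_of_square[OF lin x(1), of "sqrt m"] x by (metis real_sqrt_pow2)
  have "\<bar>l\<bar> * norm z \<le> norm (f z)" for z
  proof (rule power2_le_imp_le)
    show "(\<bar>l\<bar> * norm z)\<^sup>2 \<le> (norm (f z))\<^sup>2"
      using m[of z] ly(3) m0 sym[of z "f z"] by (simp add: power_mult_distrib power2_norm_eq_inner)
  qed simp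
  then show thesis using that ly by blast
qed

text \<open>The least eigenvalue of minus the square of \<open>f\<close> gives the sharp upper bound
  in the same way.\<close>

lemma self_adjoint_largest_modulus:
  fixes f :: "'a::euclidean_space \<Rightarrow> 'a"
  assumes f: "self_adjoint f"
  obtains l x where "x \<noteq> 0" "f x = l *\<^sub>R x" "\<And>y. norm (f y) \<le> \<bar>l\<bar> * norm y"
proof -
  have lin: "linear f" and sym: "\<And>x y. f x \<bullet> y = x \<bullet> f y"
    using f by (auto simp: self_adjoint_def)
  obtain m x where x: "x \<noteq> 0" "- f (f x) = m *\<^sub>R x" and m: "\<And>y. m * (norm y)\<^sup>2 \<le> y \<bullet> (- f (f y))"
    using self_adjoint_least_eigenvalue[OF self_adjoint_uminus[OF self_adjoint_square[OF f]]] by metis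
  have x2: "f (f x) = (- m) *\<^sub>R x" using x(2) by (metis add.inverse_inverse scaleR_minus_left)
  then have "(- m) * (norm x)\<^sup>2 = (norm (f x))\<^sup>2"
    using sym[of x "f x"] by (simp add: power2_norm_eq_inner)
  then have m0: "- m \<ge> 0"
    using x(1) by (metis mult_less_0_iff not_less zero_less_norm_iff zero_less_power zero_le_power2)
  then obtain l y where ly: "y \<noteq> 0" "f y = l *\<^sub>R y" "\<bar>l\<bar> = \<bar>sqrt (- m)\<bar>"
    using eigenvalue_of_square[OF lin x(1), of "sqrt (- m)"] x2 by (metis real_sqrt_pow2)
  have "norm (f z) \<le> \<bar>l\<bar> * norm z" for z
  proof (rule power2_le_imp_le)
    show "(norm (f z))\<^sup>2 \<le> (\<bar>l\<bar> * norm z)\<^sup>2"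
      using m[of z] ly(3) m0 sym[of z "f z"]
      by (simp add: power_mult_distrib power2_norm_eq_inner)
  qed simp
  then show thesis using that ly by blast
qed

text \<open>With \<open>X = I - f / m\<close>, the equation \<open>Y = (X + Y\<^sup>2) / 2\<close>
  says \<open>(I - Y)\<^sup>2 = f / m\<close>. For large \<open>m\<close> the norm of
  \<open>X\<close> is below 1 and a contraction on self-adjoint operators yields \<open>Y\<close>;
  the root is \<open>sqrt m\<close> times \<open>I - Y\<close>.\<close>

lemma positive_operator_sqrt:
  fixes f :: "'a::euclidean_space \<Rightarrow> 'a"
  assumes f: "self_adjoint f" and pos: "\<And>x. x \<noteq> 0 \<Longrightarrow> 0 < x \<bullet> f x"
  obtains g where "self_adjoint g" "\<And>x. 0 \<le> x \<bullet> g x" "\<And>x. g (g x) = f x"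
proof -
  have lin: "linear f" and sym: "\<And>x y. f x \<bullet> y = x \<bullet> f y"
    using f by (auto simp: self_adjoint_def)
  obtain a x0 where x0: "x0 \<noteq> 0" "f x0 = a *\<^sub>R x0" and a: "\<And>y. a * (norm y)\<^sup>2 \<le> y \<bullet> f y"
    using self_adjoint_least_eigenvalue[OF f] by metis
  have a0: "a > 0" using pos[OF x0(1)] x0 inner_ge_zero[of x0] by (auto simp: zero_less_mult_iff)
  obtain K where K: "K > 0" "\<And>x. norm (f x) \<le> K * norm x"
    using linear_bounded_pos[OF lin] by metis
  \<comment> \<open>Chosen so that \<open>K\<^sup>2 \<le> a * m\<close> and \<open>a < m\<close>;
    then the squared norm of \<open>X\<close> is at most \<open>1 - a / m\<close>, a number strictly
    between 0 and 1.\<close>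
  define m where "m = K\<^sup>2 / a + a"
  have m0: "m > 0" using a0 K by (simp add: m_def add_pos_pos)
  have am: "a / m < 1" using a0 K m0 by (simp add: m_def)
  have Km: "K\<^sup>2 / m\<^sup>2 \<le> a / m"
  proof -
    have "K\<^sup>2 \<le> a * m" using a0 by (simp add: m_def field_simps)
    then show ?thesis using m0 by (simp add: field_simps power2_eq_square)
  qed
  define q where "q = sqrt (1 - a / m)"
  have q: "0 < q" "q < 1" using am a0 m0 by (auto simp: q_def)
  define X where "X = Blinfun (\<lambda>x. x - (1 / m) *\<^sub>R f x)"
  have X: "blinfun_apply X x = x - (1 / m) *\<^sub>R f x" for x
    unfolding X_def using lin
    by (subst bounded_linear_Blinfun_apply)
      (auto intro!: bounded_linear_intros simp: linear_conv_bounded_linear)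
  have nX: "norm X \<le> q"
  proof (rule norm_blinfun_bound)
    fix x
    have "(norm (X x))\<^sup>2 = (norm x)\<^sup>2 - 2 / m * (x \<bullet> f x) + (norm (f x))\<^sup>2 / m\<^sup>2"
      unfolding X power2_norm_eq_inner
      by (simp add: inner_diff_left inner_diff_right sym power2_eq_square diff_divide_distrib)
    also have "\<dots> \<le> (norm x)\<^sup>2 - 2 / m * (a * (norm x)\<^sup>2) + (K * norm x)\<^sup>2 / m\<^sup>2"
      using a[of x] K(2)[of x] m0
      by (intro add_mono diff_mono mult_left_mono divide_right_mono power_mono) auto
    also have "\<dots> = (norm x)\<^sup>2 * (1 - 2 * (a / m) + K\<^sup>2 / m\<^sup>2)"
      by (simp add: algebra_simps power_mult_distrib)
    also have "\<dots> \<le> (norm x)\<^sup>2 * (1 - a / m)"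
      using Km by (intro mult_left_mono) auto
    also have "\<dots> = (q * norm x)\<^sup>2"
      using am by (simp add: q_def power_mult_distrib)
    finally show "norm (X x) \<le> q * norm x"
      using q by (rule_tac power2_le_imp_le) auto
  qed (use q in simp)
  define S where "S = {Y :: 'a \<Rightarrow>\<^sub>L 'a. norm Y \<le> q \<and> (\<forall>x y. blinfun_apply Y x \<bullet> y = x \<bullet> blinfun_apply Y y)}"
  define F where "F = (\<lambda>Y :: 'a \<Rightarrow>\<^sub>L 'a. (1/2) *\<^sub>R (X + (Y o\<^sub>L Y)))"
  have "\<exists>!Y\<in>S. F Y = Y"
  proof (rule Banach_fix)
    have "S = cball 0 q \<inter> (\<Inter>x. \<Inter>y. {Y. blinfun_apply Y x \<bullet> y = x \<bullet> blinfun_apply Y y})"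
      by (auto simp: S_def)
    moreover have "closed \<dots>"
      by (intro closed_Int closed_cball closed_INT ballI closed_Collect_eq continuous_intros)
    ultimately show "complete S" by (simp add: complete_eq_closed)
    show "S \<noteq> {}" using q by (auto simp: S_def intro!: exI[of _ 0])
    show "F ` S \<subseteq> S"
    proof safe
      fix Y assume Y: "Y \<in> S"
      have "norm (F Y) \<le> (1/2) * (q + q * q)"
        unfolding F_def norm_scaleR using Y nX q
        by (auto simp: S_def intro!: order_trans[OF norm_triangle_ineq] add_mono
            order_trans[OF norm_blinfun_compose] mult_mono)
      also have "\<dots> \<le> q" using q mult_left_le[of q q] by auto
      finally show "F Y \<in> S" using Y
        by (auto simp: S_def F_def X blinfun.bilinear_simps inner_add_left inner_add_right
            inner_diff_left inner_diff_right sym)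
    qed
    show "dist (F Y) (F Z) \<le> q * dist Y Z" if "Y \<in> S" "Z \<in> S" for Y Z
    proof -
      \<comment> \<open>This splitting of the difference of squares holds for noncommuting
        \<open>Y\<close> and \<open>Z\<close>; each summand contributes at most \<open>q\<close>
        times the distance.\<close>
      have "F Y - F Z = (1/2) *\<^sub>R ((Y o\<^sub>L (Y - Z)) + ((Y - Z) o\<^sub>L Z))"
        by (intro blinfun_eqI) (simp add: F_def blinfun.bilinear_simps algebra_simps)
      also have "norm \<dots> \<le> (1/2) * (q * norm (Y - Z) + norm (Y - Z) * q)"
      proof -
        have "norm (Y o\<^sub>L (Y - Z)) \<le> q * norm (Y - Z)" "norm ((Y - Z) o\<^sub>L Z) \<le> norm (Y - Z) * q"
          by (rule order_trans[OF norm_blinfun_compose], use that in \<open>simp add: S_def mult_right_mono mult_left_mono\<close>)+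
        then have "norm ((Y o\<^sub>L (Y - Z)) + ((Y - Z) o\<^sub>L Z)) \<le> q * norm (Y - Z) + norm (Y - Z) * q"
          by (intro order_trans[OF norm_triangle_ineq] add_mono)
        then show ?thesis unfolding norm_scaleR by simp
      qed
      finally show ?thesis by (simp add: dist_norm)
    qed
  qed (use q in auto)
  then obtain Y where Y: "Y \<in> S" "F Y = Y" by blast
  have Ysym: "Y x \<bullet> y = x \<bullet> Y y" for x y using Y by (simp add: S_def)
  have fixpt: "2 *\<^sub>R Y x = X x + Y (Y x)" for x
  proof -
    have "2 *\<^sub>R Y = 2 *\<^sub>R F Y" using Y by simp
    also have "\<dots> = X + (Y o\<^sub>L Y)" by (simp add: F_def)
    finally have "(2 *\<^sub>R Y) x = (X + (Y o\<^sub>L Y)) x" by simp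
    then show ?thesis by (simp add: blinfun.bilinear_simps)
  qed
  define g where "g = (\<lambda>x. sqrt m *\<^sub>R (x - Y x))"
  have lg: "linear g"
    unfolding g_def
    by (rule linearI) (simp_all add: blinfun.bilinear_simps algebra_simps)
  have "self_adjoint g"
    using lg by (auto simp: self_adjoint_def g_def inner_diff_left inner_diff_right Ysym)
  moreover have "0 \<le> x \<bullet> g x" for x
  proof -
    have "x \<bullet> Y x \<le> norm x * norm (Y x)" by (rule norm_cauchy_schwarz)
    also have "norm (Y x) \<le> norm Y * norm x" by (rule norm_blinfun)
    also have "\<dots> \<le> 1 * norm x" using Y q by (intro mult_right_mono) (auto simp: S_def)
    finally have "x \<bullet> Y x \<le> x \<bullet> x" by (simp add: dot_square_norm power2_eq_square mult_left_mono)
    then show ?thesis using m0 by (simp add: g_def inner_diff_right)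
  qed
  moreover have "g (g x) = f x" for x
  proof -
    have "g (g x) = m *\<^sub>R (x - 2 *\<^sub>R Y x + Y (Y x))"
      using m0 by (simp add: g_def blinfun.bilinear_simps scaleR_diff_right scaleR_add_right scaleR_2)
    also have "\<dots> = m *\<^sub>R (x - X x)" by (simp add: fixpt)
    also have "\<dots> = f x" using m0 by (simp add: X)
    finally show ?thesis .
  qed
  ultimately show thesis using that by blast
qed

text \<open>Test the eigenvector \<open>x\<close> of \<open>g - h\<close> for its eigenvalue
  \<open>l\<close> of largest modulus. Equality of the squares forces
  \<open>l * (x \<bullet> g x + x \<bullet> h x) = 0\<close>, and injectivity makes the bracket
  positive, so \<open>l = 0\<close> and \<open>g - h\<close> vanishes.\<close>

lemma positive_operator_sqrt_unique:
  fixes f g h :: "'a::euclidean_space \<Rightarrow> 'a"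
  assumes g: "self_adjoint g" "\<And>x. 0 \<le> x \<bullet> g x" "\<And>x. g (g x) = f x"
    and h: "self_adjoint h" "\<And>x. 0 \<le> x \<bullet> h x" "\<And>x. h (h x) = f x"
    and inj: "\<And>x. f x = 0 \<Longrightarrow> x = 0"
  shows "g = h"
proof -
  have lin: "linear g" "linear h" using g h by (auto simp: self_adjoint_def)
  have sym: "g x \<bullet> y = x \<bullet> g y" "h x \<bullet> y = x \<bullet> h y" for x y
    using g h by (auto simp: self_adjoint_def)
  have D: "self_adjoint (\<lambda>x. g x - h x)"
    unfolding self_adjoint_def by (auto intro!: linear_compose_sub lin simp: inner_diff sym)
  obtain l x where x: "x \<noteq> 0" "g x - h x = l *\<^sub>R x"
    and l: "\<And>y. norm (g y - h y) \<le> \<bar>l\<bar> * norm y"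
    using self_adjoint_largest_modulus[OF D] by blast
  have gx: "x \<bullet> g x > 0"
  proof -
    have "x \<bullet> g x \<noteq> 0"
      using self_adjoint_nonneg_kernel[OF g(1,2)] g(3)[of x] inj[of x] x(1) lin(1)
      by (metis linear_0)
    then show ?thesis using g(2)[of x] by simp
  qed
  have "l * (x \<bullet> g x) + l * (x \<bullet> h x) = x \<bullet> g (g x - h x) + (g x - h x) \<bullet> h x"
    by (simp add: x linear_cmul[OF lin(1)])
  also have "\<dots> = 0"
    by (simp add: inner_diff_left inner_diff_right linear_diff[OF lin(1)] sym g h)
  finally have "l * (x \<bullet> g x + x \<bullet> h x) = 0" by (simp add: distrib_left)
  then have "l = 0" using gx h(2)[of x] by auto
  then have "g y = h y" for y using l[of y] by simp
  then show ?thesis by blast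
qed

section \<open>Square roots and inverses of real symmetric matrices\<close>

lemma self_adjoint_symmetric_matrix:
  fixes M :: "real^'n^'n"
  shows "self_adjoint ((*v) M) \<longleftrightarrow> transpose M = M"
proof
  assume "transpose M = M"
  then show "self_adjoint ((*v) M)"
    by (auto simp: self_adjoint_def dot_lmul_matrix simp flip: transpose_matrix_vector)
      (metis dot_lmul_matrix transpose_matrix_vector)
next
  assume *: "self_adjoint ((*v) M)"
  have "transpose M *v x = M *v x" for x
  proof -
    have "(transpose M *v x) \<bullet> y = (M *v x) \<bullet> y" for y
      using * by (simp add: self_adjoint_def dot_lmul_matrix transpose_matrix_vector)
    then show ?thesis using vector_eq_rdot by blast
  qed
  then show "transpose M = M" by (simp add: matrix_eq)
qed

text \<open>The description defining \<open>msqrt\<close> can be evaluated only after existence and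
  uniqueness are both known; the two operator lemmas supply them.\<close>

lemma msqrt_pos_def:
  fixes M :: "real^'n^'n"
  assumes sym: "transpose M = M" and pos: "pos_def M"
  shows "transpose (msqrt M) = msqrt M" "msqrt M ** msqrt M = M"
proof -
  let ?P = "\<lambda>S. transpose S = S \<and> pos_semidef S \<and> S ** S = M"
  have sa: "self_adjoint ((*v) M)" using sym by (simp add: self_adjoint_symmetric_matrix)
  obtain g where g: "self_adjoint g" "\<And>x. 0 \<le> x \<bullet> g x" "\<And>x. g (g x) = M *v x"
    using positive_operator_sqrt[OF sa] pos by (auto simp: pos_def_def)
  then have "g = (*v) (matrix g)" by (simp add: self_adjoint_def fun_eq_iff matrix_works)
  then have ex: "?P (matrix g)"
    using g by (metis matrix_eq matrix_vector_mul_assoc pos_semidef_def self_adjoint_symmetric_matrix)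
  have inj: "x = 0" if "M *v x = 0" for x
    using pos that by (force simp: pos_def_def)
  have uniq: "S = T" if "?P S" "?P T" for S T
  proof -
    have "(*v) S = (*v) T"
      by (rule positive_operator_sqrt_unique[where f = "(*v) M"])
        (use that inj in \<open>auto simp: self_adjoint_symmetric_matrix pos_semidef_def matrix_vector_mul_assoc\<close>)
    then show ?thesis by (metis matrix_eq)
  qed
  have "?P (msqrt M)" unfolding msqrt_def
    by (rule theI[of ?P, OF ex]) (use uniq ex in blast)
  then show "transpose (msqrt M) = msqrt M" "msqrt M ** msqrt M = M" by auto
qed

lemma invertible_msqrt:
  fixes M :: "real^'n^'n"
  assumes "transpose M = M" "pos_def M"
  shows "invertible (msqrt M)"
proof -
  have "x = 0" if "msqrt M *v x = 0" for x
  proof -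
    have "M *v x = msqrt M *v (msqrt M *v x)"
      by (simp add: matrix_vector_mul_assoc msqrt_pos_def[OF assms])
    then show ?thesis using assms(2) that by (force simp: pos_def_def)
  qed
  then show ?thesis
    by (metis invertible_left_inverse matrix_left_invertible_ker)
qed

lemma matrix_inv_inverse:
  assumes "invertible A"
  shows "A ** matrix_inv A = mat 1" "matrix_inv A ** A = mat 1"
  unfolding matrix_inv_def
  using someI_ex[OF assms[unfolded invertible_def]] by auto

lemma transpose_matrix_inv:
  fixes S :: "real^'n^'n"
  assumes "transpose S = S" "invertible S"
  shows "transpose (matrix_inv S) = matrix_inv S"
proof -
  have 1: "matrix_inv S ** S = mat 1" "S ** matrix_inv S = mat 1"
    using assms(2) by (simp_all add: matrix_inv_inverse)
  have "S ** transpose (matrix_inv S) = mat 1"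
    using 1(1) assms(1) by (metis matrix_transpose_mul transpose_mat)
  then show ?thesis by (metis 1(1) matrix_mul_assoc matrix_mul_lid matrix_mul_rid)
qed

section \<open>Hermitian matrices and orthogonal projections\<close>

text \<open>Reduces the Hermitian product to the real inner product of the underlying Euclidean
  space, so the results on real self-adjoint operators apply to complex matrices.\<close>

lemma cdot_eq_Complex: "cdot x y = Complex (x \<bullet> y) ((\<i> *s x) \<bullet> y)"
  by (simp add: cdot_def complex_eq_iff inner_vec_def Re_sum Im_sum inner_complex_def)

lemma cdot_eq_0_iff: "cdot x y = 0 \<longleftrightarrow> x \<bullet> y = 0 \<and> (\<i> *s x) \<bullet> y = 0"
  by (simp add: cdot_eq_Complex complex_eq_iff)

lemma inner_cdot: "x \<bullet> y = Re (cdot x y)"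
  by (simp add: cdot_eq_Complex)

lemma inner_i_left: "(\<i> *s x) \<bullet> (y :: complex^'k) = - (x \<bullet> (\<i> *s y))"
  by (simp add: inner_vec_def inner_complex_def flip: sum_negf)

lemma inner_i_i [simp]: "(\<i> *s x) \<bullet> (\<i> *s y) = x \<bullet> (y :: complex^'k)"
  by (simp add: inner_vec_def inner_complex_def algebra_simps)

lemma inner_i_self [simp]: "(\<i> *s x) \<bullet> (x :: complex^'k) = 0" "x \<bullet> (\<i> *s x) = 0"
  by (simp_all add: inner_vec_def inner_complex_def algebra_simps)

lemma norm_complex_scale: "norm (z *s (x :: complex^'k)) = cmod z * norm x"
  by (simp add: norm_vec_def norm_mult L2_set_right_distrib)

lemma complex_scale_eq: "z *s (x :: complex^'k) = Re z *\<^sub>R x + Im z *\<^sub>R (\<i> *s x)"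
  by (simp add: vec_eq_iff complex_eq_iff)

lemma scaleR_eq_complex_scale: "r *\<^sub>R (x :: complex^'k) = complex_of_real r *s x"
  by (simp add: vec_eq_iff complex_eq_iff)

lemma linear_complex_matrix: "linear ((*v) (M :: complex^'k^'m))"
  by (rule linearI)
    (simp_all add: matrix_vector_right_distrib scaleR_eq_complex_scale vector_scalar_commute)

lemma complex_matrix_scaleR: "(M :: complex^'k^'m) *v (r *\<^sub>R x) = r *\<^sub>R (M *v x)"
  by (rule linear_cmul[OF linear_complex_matrix])

lemma self_adjoint_complex_matrixI:
  fixes M :: "complex^'k^'k"
  assumes "\<And>i j. M $ i $ j = cnj (M $ j $ i)"
  shows "self_adjoint ((*v) M)"
proof -
  have "cdot (M *v x) y = cdot x (M *v y)" for x y
  proof -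
    have "cdot (M *v x) y = (\<Sum>i\<in>UNIV. \<Sum>j\<in>UNIV. cnj (x $ j) * (cnj (M $ i $ j) * y $ i))"
      by (simp add: cdot_def matrix_vector_mult_def sum_distrib_left sum_distrib_right mult_ac)
    also have "\<dots> = (\<Sum>j\<in>UNIV. \<Sum>i\<in>UNIV. cnj (x $ j) * (cnj (M $ i $ j) * y $ i))"
      by (rule sum.swap)
    also have "\<dots> = cdot x (M *v y)"
      by (simp add: cdot_def matrix_vector_mult_def sum_distrib_left flip: assms)
    finally show ?thesis .
  qed
  then show ?thesis by (simp add: self_adjoint_def linear_complex_matrix inner_cdot)
qed

text \<open>Multiplication by \<open>\<i>\<close> is skew and commutes with the symmetric
  \<open>M\<close>, so the value equals its own negative. In complex terms, the quadratic form of a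
  Hermitian matrix is real.\<close>

lemma hermitian_inner_i:
  fixes M :: "complex^'k^'k"
  assumes "self_adjoint ((*v) M)"
  shows "(\<i> *s x) \<bullet> (M *v x) = 0"
proof -
  have "(\<i> *s x) \<bullet> (M *v x) = (M *v (\<i> *s x)) \<bullet> x" using assms by (simp add: self_adjoint_def)
  also have "\<dots> = - ((M *v x) \<bullet> (\<i> *s x))" by (simp add: vector_scalar_commute inner_i_left)
  finally show ?thesis by (simp add: inner_commute)
qed

section \<open>Spectra of Hermitian matrices\<close>

lemma spec_iff: "\<zeta> \<in> spec M \<longleftrightarrow> (\<exists>x. x \<noteq> 0 \<and> M *v x = \<zeta> *s x)"
  by (simp add: spec_def spec_on_def)

lemma real_spec_iff: "r \<in> real_spec M \<longleftrightarrow> (\<exists>x. x \<noteq> 0 \<and> M *v x = r *\<^sub>R x)"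
  by (simp add: real_spec_def spec_iff scaleR_eq_complex_scale)

lemma hermitian_spec_real:
  assumes "self_adjoint ((*v) M)" "\<zeta> \<in> spec M"
  obtains r where "r \<in> real_spec M" "\<zeta> = complex_of_real r"
proof -
  obtain x where x: "x \<noteq> 0" "M *v x = \<zeta> *s x" using assms by (auto simp: spec_iff)
  have "Im \<zeta> * (x \<bullet> x) = (\<i> *s x) \<bullet> (\<zeta> *s x)"
    by (simp add: complex_scale_eq[of \<zeta>] inner_add_right)
  also have "\<dots> = 0" using hermitian_inner_i[OF assms(1), of x] x by simp
  finally have "\<zeta> = complex_of_real (Re \<zeta>)" using x by (simp add: complex_eq_iff)
  then show thesis using that[of "Re \<zeta>"] assms(2) by (simp add: real_spec_def)
qed

text \<open>Resolvent bound: \<open>r\<close> is the eigenvalue nearest to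
  \<open>Re \<zeta>\<close>, found from the eigenvalue of smallest modulus of
  \<open>M - Re \<zeta>\<close>. One \<open>r\<close> serves all \<open>u\<close>.\<close>

lemma hermitian_spec_dist:
  fixes M :: "complex^'k^'k"
  assumes M: "self_adjoint ((*v) M)"
  obtains r where "r \<in> real_spec M"
    "\<And>u. cmod (\<zeta> - complex_of_real r) * norm u \<le> norm (\<zeta> *s u - M *v u)"
proof -
  let ?f = "\<lambda>u. M *v u - Re \<zeta> *\<^sub>R u"
  have "self_adjoint ?f"
    using M by (auto intro!: linear_compose_sub linear_complex_matrix linear_scale_self
        simp: self_adjoint_def inner_diff_left inner_diff_right)
  then obtain l x where x: "x \<noteq> 0" "?f x = l *\<^sub>R x" and l: "\<And>u. \<bar>l\<bar> * norm u \<le> norm (?f u)"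
    using self_adjoint_smallest_modulus[of ?f] by blast
  define r where "r = Re \<zeta> + l"
  have "M *v x = r *\<^sub>R x" using x by (simp add: r_def algebra_simps)
  then have "r \<in> real_spec M" using x by (auto simp: real_spec_iff)
  moreover have "cmod (\<zeta> - complex_of_real r) * norm u \<le> norm (\<zeta> *s u - M *v u)" for u
  proof (rule power2_le_imp_le)
    define w where "w = ?f u"
    have e: "\<zeta> *s u - M *v u = Im \<zeta> *\<^sub>R (\<i> *s u) - w"
      by (simp add: complex_scale_eq[of \<zeta>] w_def)
    \<comment> \<open>The contributions of \<open>Im \<zeta>\<close> and of the Hermitian part are
      orthogonal, so their squared norms add.\<close>
    have "(\<i> *s u) \<bullet> w = 0"
      using hermitian_inner_i[OF M, of u] by (simp add: w_def inner_diff_right)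
    then have "(norm (\<zeta> *s u - M *v u))\<^sup>2 = (norm w)\<^sup>2 + (Im \<zeta>)\<^sup>2 * (norm u)\<^sup>2"
      unfolding power2_norm_eq_inner e
      by (simp add: inner_diff_left inner_diff_right power2_eq_square inner_commute)
    moreover have "(cmod (\<zeta> - complex_of_real r) * norm u)\<^sup>2 = (\<bar>l\<bar> * norm u)\<^sup>2 + (Im \<zeta>)\<^sup>2 * (norm u)\<^sup>2"
      by (simp add: power_mult_distrib cmod_power2 r_def distrib_right)
    moreover have "(\<bar>l\<bar> * norm u)\<^sup>2 \<le> (norm w)\<^sup>2"
      using l[of u] by (intro power_mono) (auto simp: w_def)
    ultimately show "(cmod (\<zeta> - complex_of_real r) * norm u)\<^sup>2 \<le> (norm (\<zeta> *s u - M *v u))\<^sup>2"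
      by simp
  qed simp
  ultimately show thesis using that by blast
qed

section \<open>Orthogonal projections onto complex subspaces\<close>

lemma ortho_proj_unique_aux:
  assumes S: "vec.subspace S" and p: "p \<in> S" "\<And>y. y \<in> S \<Longrightarrow> y \<bullet> (x - p) = 0"
    and q: "q \<in> S" "\<And>y. y \<in> S \<Longrightarrow> y \<bullet> (x - q) = (0::real)"
  shows "p = (q :: complex^'k)"
proof -
  have "p - q \<in> S" using S p q by (simp add: vec.subspace_diff)
  then have "(p - q) \<bullet> (x - q) - (p - q) \<bullet> (x - p) = 0" using p q by simp
  then show ?thesis by (simp flip: inner_diff_right)
qed

text \<open>The real orthogonal decomposition also works for \<open>cdot\<close> because
  \<open>S\<close> is stable under multiplication by \<open>\<i>\<close>. Uniqueness of the
  decomposition makes the projection complex linear, hence a matrix, which resolves the description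
  in \<open>ortho_proj\<close>.\<close>

lemma
  fixes S :: "(complex^'k) set"
  assumes S: "vec.subspace S"
  shows ortho_proj_in: "ortho_proj S *v x \<in> S"
    and ortho_proj_orthogonal: "y \<in> S \<Longrightarrow> y \<bullet> (x - ortho_proj S *v x) = 0"
proof -
  have mul: "z *s y \<in> S" if "y \<in> S" for y z using S that by (simp add: vec.subspace_scale)
  have sub: "subspace S"
    using S by (auto simp: subspace_def vec.subspace_def scaleR_eq_complex_scale)
  have "\<exists>p. p \<in> S \<and> (\<forall>y\<in>S. y \<bullet> (x - p) = 0)" for x
    using orthogonal_subspace_decomp_exists[of S x] sub
    by (metis add_diff_cancel_left' orthogonal_def inner_commute span_eq_iff)
  then obtain p where p: "\<And>x. p x \<in> S" "\<And>x y. y \<in> S \<Longrightarrow> y \<bullet> (x - p x) = 0" by metis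
  have uniq: "p x = q" if "q \<in> S" "\<And>y. y \<in> S \<Longrightarrow> y \<bullet> (x - q) = 0" for x q
    using ortho_proj_unique_aux[OF S p] that by blast
  have "Vector_Spaces.linear (*s) (*s) p"
  proof (intro Vector_Spaces.linear_iff[THEN iffD2] conjI allI vec.vector_space_axioms)
    fix x y :: "complex^'k" and z
    show "p (x + y) = p x + p y"
    proof (rule uniq)
      show "w \<bullet> (x + y - (p x + p y)) = 0" if "w \<in> S" for w
        using p(2)[OF that, of x] p(2)[OF that, of y] by (simp add: inner_diff_right inner_add_right)
    qed (use S p in \<open>simp add: vec.subspace_add\<close>)
    show "p (z *s x) = z *s p x"
    proof (rule uniq)
      show "w \<bullet> (z *s x - z *s p x) = 0" if "w \<in> S" for w
      proof -
        have "w \<bullet> (z *s x - z *s p x) = w \<bullet> (z *s (x - p x))" by (simp add: vector_ssub_ldistrib)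
        also have "\<dots> = Re z * (w \<bullet> (x - p x)) - Im z * ((\<i> *s w) \<bullet> (x - p x))"
          by (subst complex_scale_eq) (simp add: inner_add_right inner_i_left)
        finally show ?thesis using p(2) that mul by simp
      qed
    qed (use p mul in simp)
  qed
  then have m: "matrix p *v x = p x" for x by (rule matrix_works)
  let ?Q = "\<lambda>P. \<forall>x. P *v x \<in> S \<and> (\<forall>y\<in>S. cdot y (x - P *v x) = 0)"
  have "?Q (ortho_proj S)"
    unfolding ortho_proj_def
  proof (rule theI)
    show "?Q (matrix p)" using p mul by (simp add: m cdot_eq_0_iff)
    show "P = matrix p" if "?Q P" for P
    proof -
      have "P *v x = matrix p *v x" for x
        unfolding m by (rule uniq[symmetric]) (use that in \<open>auto simp: cdot_eq_0_iff\<close>)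
      then show ?thesis by (simp add: matrix_eq)
    qed
  qed
  then show "ortho_proj S *v x \<in> S" "y \<in> S \<Longrightarrow> y \<bullet> (x - ortho_proj S *v x) = 0"
    by (auto simp: cdot_eq_0_iff)
qed

lemma ortho_proj_unique:
  fixes S :: "(complex^'k) set"
  assumes S: "vec.subspace S" and q: "q \<in> S" "\<And>y. y \<in> S \<Longrightarrow> y \<bullet> (x - q) = 0"
  shows "ortho_proj S *v x = q"
  using ortho_proj_unique_aux[OF S ortho_proj_in[OF S] ortho_proj_orthogonal[OF S] q] .

lemma ortho_proj_fixes:
  assumes "vec.subspace S" "x \<in> S"
  shows "ortho_proj S *v x = x"
  using assms by (intro ortho_proj_unique) auto

lemma self_adjoint_ortho_proj:
  fixes S :: "(complex^'k) set"
  assumes S: "vec.subspace S"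
  shows "self_adjoint ((*v) (ortho_proj S))"
proof -
  have "(ortho_proj S *v x) \<bullet> y = x \<bullet> (ortho_proj S *v y)" for x y
    using ortho_proj_orthogonal[OF S ortho_proj_in[OF S], of x y]
      ortho_proj_orthogonal[OF S ortho_proj_in[OF S], of y x]
    by (simp add: inner_diff_right inner_commute)
  then show ?thesis by (simp add: self_adjoint_def linear_complex_matrix)
qed

lemma norm_ortho_proj_le:
  fixes S :: "(complex^'k) set"
  assumes S: "vec.subspace S"
  shows "norm (ortho_proj S *v x) \<le> norm x" "norm (x - ortho_proj S *v x) \<le> norm x"
proof -
  let ?p = "ortho_proj S *v x"
  have "(norm ?p)\<^sup>2 + (norm (x - ?p))\<^sup>2 = (norm (?p + (x - ?p)))\<^sup>2"
    using ortho_proj_orthogonal[OF S ortho_proj_in[OF S], of x x]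
    by (intro norm_add_Pythagorean[symmetric]) (simp add: orthogonal_def)
  then have *: "(norm ?p)\<^sup>2 + (norm (x - ?p))\<^sup>2 = (norm x)\<^sup>2" by simp
  then show "norm ?p \<le> norm x" "norm (x - ?p) \<le> norm x"
    by (metis le_add_same_cancel1 le_add_same_cancel2 norm_ge_zero power2_le_imp_le zero_le_power2)+
qed

lemma subspace_mat_ker: "vec.subspace (mat_ker M)"
  by (auto simp: vec.subspace_def mat_ker_def matrix_vector_right_distrib vector_scalar_commute)

section \<open>Eigenvalues of complex matrices\<close>

text \<open>The map iterated in \<open>gen_eigenspace\<close>; with a name for it, a product of
  factors \<open>M - z\<close> over a list of scalars becomes a \<open>foldr\<close>.\<close>

definition shift_op :: "complex^'k^'k \<Rightarrow> complex \<Rightarrow> complex^'k \<Rightarrow> complex^'k" where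
  "shift_op M \<zeta> = (\<lambda>v. M *v v - \<zeta> *s v)"

lemma shift_op_linear:
  "shift_op M z 0 = 0"
  "shift_op M z (x + y) = shift_op M z x + shift_op M z y"
  "shift_op M z (c *s x) = c *s shift_op M z x"
  by (simp_all add: shift_op_def matrix_vector_right_distrib vector_scalar_commute
      vector_ssub_ldistrib vector_add_ldistrib vector_smult_assoc mult.commute)

lemma shift_op_commute: "shift_op M z (shift_op M w v) = shift_op M w (shift_op M z v)"
  by (simp add: shift_op_def matrix_vector_mult_diff_distrib vector_scalar_commute
      vector_ssub_ldistrib vector_smult_assoc mult.commute)

lemma foldr_shift_op_commute1:
  "foldr (shift_op M) zs (shift_op M w v) = shift_op M w (foldr (shift_op M) zs v)"
proof (induction zs)
  case (Cons z zs)
  show ?case by (simp only: foldr.simps o_apply Cons.IH shift_op_commute[where z = z and w = w])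
qed simp

lemma foldr_shift_op_commute:
  "foldr (shift_op M) zs (foldr (shift_op M) ws v) = foldr (shift_op M) ws (foldr (shift_op M) zs v)"
  by (induction ws) (simp_all only: foldr.simps o_apply id_apply foldr_shift_op_commute1)

lemma foldr_shift_op_linear:
  "foldr (shift_op M) zs 0 = 0"
  "foldr (shift_op M) zs (x + y) = foldr (shift_op M) zs x + foldr (shift_op M) zs y"
  "foldr (shift_op M) zs (c *s x) = c *s foldr (shift_op M) zs x"
  by (induction zs) (simp_all add: shift_op_linear)

lemma foldr_shift_op_eigenvector:
  assumes "M *v x = \<mu> *s x"
  shows "foldr (shift_op M) zs x = (\<Prod>z\<leftarrow>zs. \<mu> - z) *s x"
proof (induction zs)
  case (Cons z zs)
  have e: "shift_op M z x = (\<mu> - z) *s x"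
    by (simp add: shift_op_def assms vector_sub_rdistrib)
  show ?case
    by (simp only: foldr.simps o_apply Cons.IH shift_op_linear e list.map prod_list.Cons
        vector_smult_assoc mult.commute)
qed simp

lemma shift_op_funpow: "(shift_op M z ^^ m) x = foldr (shift_op M) (replicate m z) x"
  by (induction m) simp_all

lemma gen_eigenspace_iff:
  "x \<in> gen_eigenspace M \<zeta> \<longleftrightarrow> (\<exists>m. foldr (shift_op M) (replicate m \<zeta>) x = 0)"
  by (simp only: gen_eigenspace_def shift_op_def[symmetric] shift_op_funpow mem_Collect_eq)

text \<open>A vector in the sum of the generalized eigenspaces is annihilated by a product of factors
  \<open>M - z\<close> with \<open>z\<close> in \<open>Z\<close>, and on an eigenvector such a product acts as a scalar.\<close>

lemma spec_on_sum_gen_eigenspaces: "spec_on M (sum_gen_eigenspaces M Z) = spec M \<inter> Z"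
proof (intro equalityI subsetI)
  fix \<mu> assume "\<mu> \<in> spec_on M (sum_gen_eigenspaces M Z)"
  then obtain x where x: "x \<in> sum_gen_eigenspaces M Z" "x \<noteq> 0" "M *v x = \<mu> *s x"
    by (auto simp: spec_on_def)
  have "\<exists>zs. set zs \<subseteq> Z \<and> foldr (shift_op M) zs x = 0"
    using x(1) unfolding sum_gen_eigenspaces_def
  proof (induction rule: vec.span_induct_alt)
    case base
    show ?case by (rule exI[of _ "[]"]) simp
  next
    case (step c y w)
    then obtain z m where zm: "z \<in> Z" "foldr (shift_op M) (replicate m z) y = 0"
      by (auto simp: gen_eigenspace_iff)
    from step obtain ws where ws: "set ws \<subseteq> Z" "foldr (shift_op M) ws w = 0" by blast
    \<comment> \<open>The factors for \<open>z\<close> annihilate \<open>y\<close> directly; on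
      \<open>w\<close> the two products are interchanged so that those of \<open>ws\<close> act
      first.\<close>
    have "foldr (shift_op M) (ws @ replicate m z) (c *s y + w) =
        c *s foldr (shift_op M) ws (foldr (shift_op M) (replicate m z) y)
        + foldr (shift_op M) ws (foldr (shift_op M) (replicate m z) w)"
      by (simp only: foldr_append o_apply foldr_shift_op_linear)
    also have "\<dots> = 0"
      unfolding foldr_shift_op_commute[of M ws "replicate m z"] zm(2) ws(2)
      by (simp add: foldr_shift_op_linear del: foldr_replicate)
    finally show ?case using ws zm by (intro exI[of _ "ws @ replicate m z"]) auto
  qed
  then obtain zs where "set zs \<subseteq> Z" "(\<Prod>z\<leftarrow>zs. \<mu> - z) *s x = 0"
    using foldr_shift_op_eigenvector[OF x(3)] by metis
  then have "\<mu> \<in> Z" using x(2) by (auto simp: prod_list_zero_iff)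
  then show "\<mu> \<in> spec M \<inter> Z" using x by (auto simp: spec_iff)
next
  fix \<mu> assume \<mu>: "\<mu> \<in> spec M \<inter> Z"
  then obtain x where x: "x \<noteq> 0" "M *v x = \<mu> *s x" by (auto simp: spec_iff)
  then have "x \<in> gen_eigenspace M \<mu>"
    unfolding gen_eigenspace_def by (intro CollectI exI[of _ 1]) simp
  then have "x \<in> sum_gen_eigenspaces M Z"
    unfolding sum_gen_eigenspaces_def using \<mu> by (intro vec.span_base) blast
  then show "\<mu> \<in> spec_on M (sum_gen_eigenspaces M Z)"
    using x by (auto simp: spec_on_def)
qed

section \<open>The characteristic polynomial and persistence of eigenvalues\<close>

lemma mat_mult_vec: "mat (z::'a::comm_semiring_1) *v x = z *s x"
proof -
  have "(\<Sum>j\<in>UNIV. (if i = j then z else 0) * x $ j) = z * x $ i" for i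
    by (subst sum.cong[OF refl, of _ _ "\<lambda>j. if i = j then z * x $ j else 0"]) auto
  then show ?thesis by (simp add: vec_eq_iff matrix_vector_mult_def mat_def)
qed

lemma spec_iff_det: "\<zeta> \<in> spec M \<longleftrightarrow> det (mat \<zeta> - M) = 0"
proof -
  have "\<zeta> \<in> spec M \<longleftrightarrow> (\<exists>x. (mat \<zeta> - M) *v x = 0 \<and> x \<noteq> 0)"
    unfolding spec_iff matrix_vector_mult_diff_rdistrib mat_mult_vec by (metis eq_iff_diff_eq_0)
  also have "\<dots> \<longleftrightarrow> \<not> invertible (mat \<zeta> - M)"
    by (metis invertible_left_inverse matrix_left_invertible_ker)
  finally show ?thesis by (simp add: invertible_det_nz)
qed

text \<open>The spectrum is the zero set of the characteristic polynomial, which is not the zero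
  polynomial because a number above the norm bound \<open>K\<close> is no eigenvalue.\<close>

lemma finite_spec: "finite (spec (M :: complex^'k^'k))"
proof -
  define p :: "complex poly"
    where "p = det (\<chi> i j. (if i = j then pCons 0 1 else 0) - pCons (M $ i $ j) 0)"
  have p: "poly p z = det (mat z - M)" for z
    unfolding p_def det_def
    by (simp add: poly_sum poly_prod mat_def if_distrib[of "\<lambda>q. poly q z"] cong: if_cong)
  obtain K where K: "K > 0" "\<And>x. norm (M *v x) \<le> K * norm x"
    using linear_bounded_pos[OF linear_complex_matrix] by metis
  have "complex_of_real (K + 1) \<notin> spec M"
  proof
    assume "complex_of_real (K + 1) \<in> spec M"
    then obtain x where "x \<noteq> 0" "M *v x = complex_of_real (K + 1) *s x" by (auto simp: spec_iff)
    moreover have "norm (complex_of_real (K + 1) *s x) = (K + 1) * norm x"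
      using K(1) by (simp add: norm_complex_scale del: of_real_add)
    ultimately show False using K(2)[of x] by (simp add: algebra_simps)
  qed
  then have "p \<noteq> 0" using p by (auto simp: spec_iff_det)
  moreover have "spec M = {z. poly p z = 0}" by (auto simp: p spec_iff_det)
  ultimately show ?thesis by (simp add: poly_roots_finite)
qed

lemma finite_real_spec: "finite (real_spec (M :: complex^'k^'k))"
  unfolding real_spec_def
  using finite_vimageI[OF finite_spec[of M] inj_of_real] by (simp add: vimage_def)

text \<open>The parameters with an eigenvalue in \<open>K\<close> form a set that is closed and, by
  Hurwitz, has closed complement in the unit interval. Connectedness then carries an eigenvalue from
  0 to 1.\<close>

lemma eigenvalue_persists:
  fixes M :: "real \<Rightarrow> complex^'k^'k"
  assumes M: "continuous_on {0..1} M"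
    and K: "compact K" "K \<subseteq> S" and S: "open S"
    and loc: "\<And>t. t \<in> {0..1} \<Longrightarrow> spec (M t) \<inter> S \<subseteq> K"
    and start: "spec (M 0) \<inter> S \<noteq> {}"
  shows "spec (M 1) \<inter> K \<noteq> {}"
proof -
  define h where "h = (\<lambda>(t, z). det (mat z - M t))"
  have entry: "(mat z - M t) $ i $ j = (if i = j then 1 else 0) * z - M t $ i $ j" for z t i j
    by (simp add: mat_def)
  have h0: "h (t, z) = 0 \<longleftrightarrow> z \<in> spec (M t)" for t z by (simp add: h_def spec_iff_det)
  have conth: "continuous_on ({0..1} \<times> C) h" for C
  proof -
    have "continuous_on ({0..1} \<times> C) (\<lambda>x. M (fst x))"
      by (rule continuous_on_compose2[OF M]) (auto intro: continuous_intros)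
    then show ?thesis
      unfolding h_def case_prod_unfold det_def entry by (intro continuous_intros)
  qed
  have holh: "(\<lambda>z. h (t, z)) holomorphic_on C" for t C
    unfolding h_def prod.case det_def entry by (intro holomorphic_intros)
  define T where "T = {t \<in> {0..1}. spec (M t) \<inter> K \<noteq> {}}"
  \<comment> \<open>\<open>T\<close> is the projection of the zero set of \<open>h\<close> in the
    compact set \<open>{0..1} \<times> K\<close>.\<close>
  have "closed T"
  proof -
    have T: "T = fst ` {x \<in> {0..1} \<times> K. h x = 0}"
      by (force simp: T_def h0)
    have "compact {x \<in> {0..1} \<times> K. h x = 0}"
      by (rule closedin_compact[OF compact_Times[OF compact_Icc K(1)]
            continuous_closedin_preimage_constant[OF conth]])
    then have "compact T"
      unfolding T by (rule compact_continuous_image[OF continuous_on_fst[OF continuous_on_id]])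
    then show ?thesis by (rule compact_imp_closed)
  qed
  moreover have "closed ({0..1} - T)"
    unfolding closed_sequential_limits
  proof (intro allI impI, elim conjE)
    fix s and t assume s: "\<forall>n::nat. s n \<in> {0..1} - T" and lim: "s \<longlonglongrightarrow> t"
    have t: "t \<in> {0..1}"
      by (rule closed_sequentially[OF closed_atLeastAtMost _ lim]) (use s in auto)
    moreover have "t \<notin> T"
    proof
      assume "t \<in> T"
      then obtain z0 where z0: "z0 \<in> K" "z0 \<in> spec (M t)" by (auto simp: T_def)
      obtain e where e: "e > 0" "ball z0 e \<subseteq> S"
        using S K(2) z0(1) open_contains_ball by blast
      \<comment> \<open>For each \<open>s n\<close> outside \<open>T\<close> the function is
        zero-free on the ball, since its zeros in \<open>S\<close> would lie in \<open>K\<close>; by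
        Hurwitz the nonconstant locally uniform limit is zero-free too.\<close>
      have "h (t, z0) \<noteq> 0"
      proof (rule Hurwitz_no_zeros[where S = "ball z0 e" and \<F> = "\<lambda>n z. h (s n, z)" and g = "\<lambda>z. h (t, z)"])
        show "uniform_limit C (\<lambda>n z. h (s n, z)) (\<lambda>z. h (t, z)) sequentially"
          if C: "compact C" for C
        proof (rule uniform_limitI)
          fix \<epsilon> :: real assume "\<epsilon> > 0"
          moreover have "uniformly_continuous_on ({0..1} \<times> C) h"
            using C by (intro compact_uniformly_continuous conth compact_Times) auto
          ultimately obtain d where d: "d > 0"
            "\<And>x x'. x \<in> {0..1} \<times> C \<Longrightarrow> x' \<in> {0..1} \<times> C \<Longrightarrow> dist x' x < d \<Longrightarrow> dist (h x') (h x) < \<epsilon>"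
            unfolding uniformly_continuous_on_def by metis
          have "\<forall>\<^sub>F n in sequentially. dist (s n) t < d"
            using lim d(1) by (rule tendstoD)
          then show "\<forall>\<^sub>F n in sequentially. \<forall>z\<in>C. dist (h (s n, z)) (h (t, z)) < \<epsilon>"
          proof eventually_elim
            case (elim n)
            then show ?case using d(2) s t by (auto simp: dist_Pair_Pair)
          qed
        qed
        \<comment> \<open>A constant would be 0, its value at \<open>z0\<close>, and put a whole
          ball into a finite spectrum.\<close>
        show "\<not> (\<lambda>z. h (t, z)) constant_on ball z0 e"
        proof
          assume "(\<lambda>z. h (t, z)) constant_on ball z0 e"
          then have "h (t, z) = h (t, z0)" if "z \<in> ball z0 e" for z
            using that e(1) unfolding constant_on_def by (metis centre_in_ball)
          then have "ball z0 e \<subseteq> spec (M t)" using z0(2) h0 by (metis subsetI)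
          then have "finite (ball z0 e)" using finite_spec finite_subset by blast
          then show False using e(1) finite_imp_not_open[of "ball z0 e"] by auto
        qed
        show "h (s n, z) \<noteq> 0" if "z \<in> ball z0 e" for n z
          using s loc[of "s n"] that e(2) unfolding h0 T_def by blast
      qed (use e in \<open>auto intro: holh\<close>)
      then show False using z0 h0 by simp
    qed
    ultimately show "t \<in> {0..1} - T" by blast
  qed
  moreover have T01: "T \<subseteq> {0..1}" "0 \<in> T" using start loc[of 0] by (auto simp: T_def)
  moreover have "connected {0..1::real}" by simp
  ultimately have "{0..1} \<inter> ({0..1} - T) = {}"
    using connected_closedD[of "{0..1}" T "{0..1} - T"] by force
  then have "1 \<in> T" by (metis DiffI IntI atLeastAtMost_iff empty_iff order_refl zero_le_one)
  then show ?thesis by (auto simp: T_def)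
qed

section \<open>Localization of the low-loss eigenvalues\<close>

text \<open>This conjugation anticommutes with the purely imaginary \<Omega> and commutes with the
  real \<open>B\<close>, which is the source of the symmetry of spectra about 0.\<close>

definition cnjv :: "complex^'k \<Rightarrow> complex^'k" where
  "cnjv x = (\<chi> i. cnj (x $ i))"

lemma cnjv_simps:
  "cnjv (cnjv x) = x" "cnjv (x + y) = cnjv x + cnjv y" "cnjv (x - y) = cnjv x - cnjv y"
  "cnjv (- x) = - cnjv x" "cnjv (r *\<^sub>R x) = r *\<^sub>R cnjv x" "cnjv 0 = 0" "cnjv x = 0 \<longleftrightarrow> x = 0"
  by (simp_all add: cnjv_def vec_eq_iff)

lemma inner_cnjv: "cnjv x \<bullet> y = x \<bullet> cnjv y"
  by (simp add: cnjv_def inner_vec_def inner_complex_def)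

lemma real_spec_uminus:
  assumes "\<And>x. M *v cnjv x = - cnjv (M *v x)" "r \<in> real_spec M"
  shows "- r \<in> real_spec M"
proof -
  obtain x where x: "x \<noteq> 0" "M *v x = r *\<^sub>R x" using assms by (auto simp: real_spec_iff)
  then have "M *v cnjv x = (- r) *\<^sub>R cnjv x" by (simp add: assms cnjv_simps)
  then show ?thesis using x(1) cnjv_simps(7) real_spec_iff by metis
qed

lemma mat_ker_iff: "x \<in> mat_ker M \<longleftrightarrow> M *v x = 0"
  by (simp add: mat_ker_def)

lemma complex_matrix_minus: "(M :: complex^'k^'m) *v (- x) = - (M *v x)"
  by (rule linear_neg[OF linear_complex_matrix])

lemma scaleR_complex_matrix_vector: "(r *\<^sub>R (M :: complex^'k^'m)) *v x = r *\<^sub>R (M *v x)"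
  by (simp add: vec_eq_iff matrix_vector_mult_def scaleR_sum_right)

lemma cmult_matrix_vector: "cmult z M *v x = z *s (M *v x)"
  by (simp add: vec_eq_iff matrix_vector_mult_def cmult_def map_matrix_def sum_distrib_left mult.assoc)

lemma A_matrix_vector: "A_matrix M B \<beta> *v x = M *v x - \<beta> *\<^sub>R (\<i> *s (B *v x))"
  unfolding A_matrix_def matrix_vector_mult_diff_rdistrib cmult_matrix_vector
  by (simp add: scaleR_eq_complex_scale vector_smult_assoc mult.commute)

text \<open>Isolates the symmetry, positivity and conjugation properties from the block form of the
  matrices, which is treated in the last section.\<close>

locale high_loss =
  fixes \<Omega> B :: "complex^'k^'k" and \<beta> :: real
  assumes herm_\<Omega>: "self_adjoint ((*v) \<Omega>)" and herm_B: "self_adjoint ((*v) B)"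
    and B_pos: "\<And>x. 0 \<le> x \<bullet> (B *v x)"
    and cnjv_\<Omega>: "\<And>x. \<Omega> *v cnjv x = - cnjv (\<Omega> *v x)" and cnjv_B: "\<And>x. B *v cnjv x = cnjv (B *v x)"
    and B_nonzero: "B \<noteq> 0" and C_nonzero: "compressed_Omega \<Omega> B \<noteq> 0"
    and \<beta>: "c_inv \<Omega> B (rho_min \<Omega> B / 2) < \<beta>"
begin

abbreviation "P \<equiv> ortho_proj (mat_ker B)"
abbreviation "C \<equiv> compressed_Omega \<Omega> B"
abbreviation "\<omega> \<equiv> omega_max \<Omega>"
abbreviation "b \<equiv> b_min B"
abbreviation "\<rho> \<equiv> rho_min \<Omega> B"
abbreviation "c \<equiv> c_fun \<Omega> B \<beta>"

lemmas P_in = ortho_proj_in[OF subspace_mat_ker[of B]]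
lemmas P_orthogonal = ortho_proj_orthogonal[OF subspace_mat_ker[of B]]
lemmas P_norm = norm_ortho_proj_le[OF subspace_mat_ker[of B]]
lemmas P_fixes = ortho_proj_fixes[OF subspace_mat_ker[of B]]
lemmas P_unique = ortho_proj_unique[OF subspace_mat_ker[of B]]
lemmas P_self_adjoint = self_adjoint_ortho_proj[OF subspace_mat_ker[of B]]

lemma sym:
  "(\<Omega> *v x) \<bullet> y = x \<bullet> (\<Omega> *v y)" "(B *v x) \<bullet> y = x \<bullet> (B *v y)" "(P *v x) \<bullet> y = x \<bullet> (P *v y)"
  using herm_\<Omega> herm_B P_self_adjoint by (auto simp: self_adjoint_def)

lemma BP: "B *v (P *v x) = 0"
  using P_in[of x] by (simp add: mat_ker_iff)

lemma PP: "P *v (P *v x) = P *v x"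
  by (rule P_fixes[OF P_in])

lemma PB: "P *v (B *v x) = 0"
  by (rule P_unique) (auto simp: mat_ker_iff simp flip: sym)

lemma C_vector: "C *v x = P *v (\<Omega> *v (P *v x))"
  by (simp add: compressed_Omega_def flip: matrix_vector_mul_assoc)

lemma herm_C: "self_adjoint ((*v) C)"
  by (simp add: self_adjoint_def linear_complex_matrix C_vector sym)

lemma cnjv_C: "C *v cnjv x = - cnjv (C *v x)"
proof -
  \<comment> \<open>\<open>Ker B\<close> is stable under conjugation, so conjugating the orthogonal
    decomposition of \<open>y\<close> gives that of \<open>cnjv y\<close>.\<close>
  have "P *v cnjv y = cnjv (P *v y)" for y
  proof (rule P_unique)
    show "cnjv (P *v y) \<in> mat_ker B"
      by (simp add: mat_ker_iff cnjv_B BP cnjv_simps)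
    show "w \<bullet> (cnjv y - cnjv (P *v y)) = 0" if "w \<in> mat_ker B" for w
      using that P_orthogonal[of "cnjv w" y]
      unfolding cnjv_simps(3)[symmetric] inner_cnjv[symmetric]
      by (simp add: mat_ker_iff cnjv_B cnjv_simps)
  qed
  then show ?thesis by (simp add: C_vector cnjv_\<Omega> complex_matrix_minus)
qed

text \<open>The norm is the largest modulus of an eigenvalue, and symmetry of the spectrum makes
  that modulus itself an eigenvalue, hence at most the maximum.\<close>

lemma norm_\<Omega>: "norm (\<Omega> *v x) \<le> \<omega> * norm x"
proof -
  obtain l y where "y \<noteq> 0" "\<Omega> *v y = l *\<^sub>R y" and l: "norm (\<Omega> *v x) \<le> \<bar>l\<bar> * norm x"
    using self_adjoint_largest_modulus[OF herm_\<Omega>] by blast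
  then have "l \<in> real_spec \<Omega>" by (auto simp: real_spec_iff)
  then have "\<bar>l\<bar> \<in> real_spec \<Omega>"
    using real_spec_uminus[OF cnjv_\<Omega>] by (auto simp: abs_if)
  then have "\<bar>l\<bar> \<le> \<omega>" unfolding omega_max_def by (intro Max_ge finite_real_spec)
  then show ?thesis using l by (meson mult_right_mono norm_ge_zero order_trans)
qed

lemma \<omega>_pos: "0 < \<omega>"
proof (rule ccontr)
  assume "\<not> 0 < \<omega>"
  then have "norm (\<Omega> *v x) \<le> 0" for x
    using norm_\<Omega>[of x] by (meson mult_nonpos_nonneg norm_ge_zero not_less order_trans)
  then have "C = 0" by (simp add: matrix_eq C_vector)
  then show False using C_nonzero by simp
qed

lemma finite_pos_spec: "finite {r \<in> real_spec C. 0 < r}"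
  by (rule finite_subset[OF _ finite_real_spec[of C]]) auto

text \<open>The minimum is over a nonempty set: a nonzero Hermitian matrix has a nonzero eigenvalue,
  and by symmetry its absolute value is one too.\<close>

lemma \<rho>: "\<rho> \<in> real_spec C" "0 < \<rho>"
proof -
  obtain l y where "y \<noteq> 0" "C *v y = l *\<^sub>R y" and l: "\<And>x. norm (C *v x) \<le> \<bar>l\<bar> * norm x"
    using self_adjoint_largest_modulus[OF herm_C] by blast
  then have "l \<in> real_spec C" by (auto simp: real_spec_iff)
  then have "\<bar>l\<bar> \<in> real_spec C"
    using real_spec_uminus[OF cnjv_C] by (auto simp: abs_if)
  moreover have "l \<noteq> 0"
  proof
    assume "l = 0"
    then have "C = 0" using l by (simp add: matrix_eq)
    then show False using C_nonzero by simp
  qed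
  ultimately have "{r \<in> real_spec C. 0 < r} \<noteq> {}" by (metis (no_types, lifting) empty_iff mem_Collect_eq zero_less_abs_iff)
  from Min_in[OF finite_pos_spec this] show "\<rho> \<in> real_spec C" "0 < \<rho>"
    by (auto simp: rho_min_def)
qed

lemma \<rho>_le: "r \<in> real_spec C \<Longrightarrow> r \<noteq> 0 \<Longrightarrow> \<rho> \<le> \<bar>r\<bar>"
proof -
  assume "r \<in> real_spec C" "r \<noteq> 0"
  then have "\<bar>r\<bar> \<in> {r \<in> real_spec C. 0 < r}"
    using real_spec_uminus[OF cnjv_C] by (auto simp: abs_if)
  then show ?thesis unfolding rho_min_def by (rule Min_le[OF finite_pos_spec])
qed

text \<open>Compressing by the projection does not increase the norm.\<close>

lemma \<rho>_le_\<omega>: "\<rho> \<le> \<omega>"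
proof -
  obtain x where x: "x \<noteq> 0" "C *v x = \<rho> *\<^sub>R x" using \<rho> by (auto simp: real_spec_iff)
  have "\<rho> * norm x = norm (P *v (\<Omega> *v (P *v x)))"
    using x \<rho>(2) by (simp flip: C_vector)
  also have "\<dots> \<le> norm (\<Omega> *v (P *v x))" by (rule P_norm)
  also have "\<dots> \<le> \<omega> * norm (P *v x)" by (rule norm_\<Omega>)
  also have "\<dots> \<le> \<omega> * norm x" using \<omega>_pos by (intro mult_left_mono P_norm) auto
  finally show ?thesis using x by simp
qed

lemma b: "b \<in> real_spec B" "0 < b"
proof -
  obtain l y where "y \<noteq> 0" "B *v y = l *\<^sub>R y" and l: "\<And>x. norm (B *v x) \<le> \<bar>l\<bar> * norm x"
    using self_adjoint_largest_modulus[OF herm_B] by blast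
  then have "l \<in> real_spec B" by (auto simp: real_spec_iff)
  moreover have "l \<noteq> 0"
  proof
    assume "l = 0"
    then have "B = 0" using l by (simp add: matrix_eq)
    then show False using B_nonzero by simp
  qed
  ultimately have "real_spec B - {0} \<noteq> {}" by blast
  then have *: "b \<in> real_spec B - {0}"
    unfolding b_min_def using finite_real_spec by (intro Min_in) auto
  then show "b \<in> real_spec B" by simp
  obtain x where x: "x \<noteq> 0" "B *v x = b *\<^sub>R x" using * by (auto simp: real_spec_iff)
  have "0 \<le> b * (x \<bullet> x)" using B_pos[of x] x by simp
  then have "0 \<le> b" using x(1) by (metis inner_gt_zero_iff mult_less_0_iff not_less)
  then show "0 < b" using * by simp
qed

text \<open>Adding \<open>b\<close> times the projection \<open>P\<close> to \<open>B\<close> moves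
  the kernel to the eigenvalue \<open>b\<close>, so the least eigenvalue of the sum is at least
  \<open>b\<close>; where \<open>P\<close> vanishes the two forms agree.\<close>

lemma b_le: "P *v v = 0 \<Longrightarrow> b * (norm v)\<^sup>2 \<le> v \<bullet> (B *v v)"
proof -
  assume v: "P *v v = 0"
  let ?f = "\<lambda>x. B *v x + b *\<^sub>R (P *v x)"
  have "self_adjoint ?f"
    unfolding self_adjoint_def
    by (auto intro!: linear_compose_add linear_complex_matrix linear_compose_scale_right
        simp: inner_add_left inner_add_right sym)
  then obtain l x where x: "x \<noteq> 0" "?f x = l *\<^sub>R x" and l: "\<And>y. l * (norm y)\<^sup>2 \<le> y \<bullet> ?f y"
    using self_adjoint_least_eigenvalue[of ?f] by blast
  have "b \<le> l"
  proof (cases "P *v x = 0")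
    case True
    then have Bx: "B *v x = l *\<^sub>R x" using x by simp
    have "l \<noteq> 0"
    proof
      assume "l = 0"
      then have "P *v x = x" using Bx by (intro P_fixes) (simp add: mat_ker_iff)
      then show False using True x by simp
    qed
    then have "l \<in> real_spec B - {0}" using Bx x by (auto simp: real_spec_iff)
    then show ?thesis unfolding b_min_def using finite_real_spec by (intro Min_le) auto
  next
    case False
    have "P *v ?f x = b *\<^sub>R (P *v x)"
      by (simp add: matrix_vector_right_distrib complex_matrix_scaleR PB PP)
    then have "l *\<^sub>R (P *v x) = b *\<^sub>R (P *v x)" by (simp add: x complex_matrix_scaleR)
    then show ?thesis using False by simp
  qed
  then have "b * (norm v)\<^sup>2 \<le> l * (norm v)\<^sup>2" by (simp add: mult_right_mono)
  also have "\<dots> \<le> v \<bullet> (B *v v)" using l[of v] v by simp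
  finally show ?thesis .
qed

lemma \<beta>_gap: "2 * \<omega> < b * \<beta>" and c_eq: "c = 2 * \<omega>\<^sup>2 / (b * \<beta> - 2 * \<omega>)"
  and c_pos: "0 < c" and c_less: "c < \<rho> / 2"
proof -
  have "0 < 2 * \<omega>\<^sup>2 / b * inverse (\<rho> / 2)" using \<omega>_pos b \<rho> by simp
  then have "2 * \<omega> / b < \<beta>" using \<beta> by (simp add: c_inv_def)
  then show gap: "2 * \<omega> < b * \<beta>" using b by (simp add: field_simps)
  have "2 * \<omega>\<^sup>2 / b * inverse (\<beta> - 2 * \<omega> / b) = 2 * \<omega>\<^sup>2 / (b * (\<beta> - 2 * \<omega> / b))"
    by (simp add: divide_inverse mult_ac)
  also have "b * (\<beta> - 2 * \<omega> / b) = b * \<beta> - 2 * \<omega>" using b(2) by (simp add: right_diff_distrib)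
  finally show c: "c = 2 * \<omega>\<^sup>2 / (b * \<beta> - 2 * \<omega>)" by (simp add: c_fun_def)
  then show "0 < c" using gap \<omega>_pos by simp
  \<comment> \<open>Multiplied by \<open>b\<close>, the hypothesis on \<beta> reads
    \<open>4 * \<omega>\<^sup>2 / \<rho> < b * \<beta> - 2 * \<omega>\<close>, a rearrangement of
    \<open>c < \<rho> / 2\<close>.\<close>
  have "b * (2 * \<omega>\<^sup>2 / b * inverse (\<rho> / 2) + 2 * \<omega> / b) < b * \<beta>"
    using \<beta> b(2) by (simp add: c_inv_def)
  also have "b * (2 * \<omega>\<^sup>2 / b * inverse (\<rho> / 2) + 2 * \<omega> / b) = 4 * \<omega>\<^sup>2 / \<rho> + 2 * \<omega>"
    using b(2) \<rho>(2) by (simp add: field_simps)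
  finally show "c < \<rho> / 2" using \<rho>(2) gap unfolding c by (simp add: field_simps)
qed

lemma \<beta>_pos: "0 < \<beta>"
proof -
  have "0 < b * \<beta>" using \<beta>_gap \<omega>_pos by linarith
  then show ?thesis using b(2) by (simp add: zero_less_mult_iff)
qed

text \<open>At \<open>t = 0\<close> the operator is block diagonal and has the nonzero eigenvalues of \<open>C\<close>; the coupling
  between \<open>Ker B\<close> and its complement is proportional to \<open>t\<close>.\<close>

definition A_path :: "real \<Rightarrow> complex^'k^'k" where
  "A_path t = A_matrix (\<Omega> - (1 - t) *\<^sub>R ((P ** \<Omega> - C) + (\<Omega> ** P - C))) B \<beta>"

lemma A_path_1: "A_path 1 = A_matrix \<Omega> B \<beta>"
  by (simp add: A_path_def)

lemma A_path_vector: "A_path t *v x = \<Omega> *v x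
    - (1 - t) *\<^sub>R ((P *v (\<Omega> *v x) - C *v x) + (\<Omega> *v (P *v x) - C *v x)) - \<beta> *\<^sub>R (\<i> *s (B *v x))"
  unfolding A_path_def A_matrix_vector matrix_vector_mult_diff_rdistrib
    matrix_vector_mult_add_rdistrib scaleR_complex_matrix_vector matrix_vector_mul_assoc[symmetric]
  by (rule refl)

lemma localization:
  assumes t: "t \<in> {0..1}" and \<zeta>: "\<zeta> \<in> spec (A_path t)" "- Im \<zeta> \<le> b * \<beta> / 2 + \<omega>"
  obtains r where "r \<in> real_spec C" "cmod (\<zeta> - complex_of_real r) \<le> c"
proof -
  obtain x where x: "x \<noteq> 0" "A_path t *v x = \<zeta> *s x" using \<zeta> by (auto simp: spec_iff)
  define u where "u = P *v x"
  define v where "v = x - P *v x"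
  have xuv: "x = u + v" by (simp add: u_def v_def)
  have Pu: "P *v u = u" by (simp add: u_def PP)
  have Pv: "P *v v = 0" by (simp add: v_def PP matrix_vector_mult_diff_distrib)
  have Bu: "B *v u = 0" by (simp add: u_def BP)
  have PiB: "P *v (\<i> *s (B *v y)) = 0" for y by (simp add: vector_scalar_commute PB)
  \<comment> \<open>Applying \<open>P\<close> removes the damping term, and of the coupling to
    \<open>v\<close> only the fraction \<open>t\<close> remains.\<close>
  have "\<zeta> *s u - C *v u = t *\<^sub>R (P *v (\<Omega> *v v))"
  proof -
    have "\<zeta> *s u = P *v (A_path t *v x)"
      by (simp add: x vector_scalar_commute u_def)
    also have "\<dots> = P *v (\<Omega> *v x) - (1 - t) *\<^sub>R (P *v (\<Omega> *v x) - C *v x)"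
      unfolding A_path_vector matrix_vector_mult_diff_distrib matrix_vector_right_distrib
        complex_matrix_scaleR PiB PP C_vector
      by simp
    also have "\<dots> = C *v u + t *\<^sub>R (P *v (\<Omega> *v v))"
      by (simp add: xuv C_vector matrix_vector_right_distrib Pu Pv algebra_simps)
    finally show ?thesis by simp
  qed
  then have "norm (\<zeta> *s u - C *v u) = t * norm (P *v (\<Omega> *v v))" using t by simp
  also have "\<dots> \<le> 1 * norm (\<Omega> *v v)" using t by (intro mult_mono P_norm) auto
  also have "\<dots> \<le> \<omega> * norm v" using norm_\<Omega> by simp
  finally have 1: "norm (\<zeta> *s u - C *v u) \<le> \<omega> * norm v" .
  have iv: "(\<i> *s v) \<bullet> (P *v y) = 0" for y
    by (simp add: vector_scalar_commute Pv flip: sym(3))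
  have "(\<i> *s v) \<bullet> (\<zeta> *s x) = Im \<zeta> * (norm v)\<^sup>2"
  proof -
    have "(\<i> *s v) \<bullet> (\<zeta> *s u) = 0"
      using iv[of "\<zeta> *s u"] by (simp add: vector_scalar_commute Pu)
    moreover have "(\<i> *s v) \<bullet> (\<zeta> *s v) = Im \<zeta> * (norm v)\<^sup>2"
      by (subst complex_scale_eq) (simp add: inner_add_right power2_norm_eq_inner)
    ultimately show ?thesis by (simp add: xuv vector_add_ldistrib inner_add_right)
  qed
  \<comment> \<open>Pairing with \<open>\<i> *s v\<close> picks out an imaginary part: \<Omega>
    drops out on \<open>v\<close> itself, while the damping survives.\<close>
  moreover have "(\<i> *s v) \<bullet> (A_path t *v x) = t * ((\<i> *s v) \<bullet> (\<Omega> *v u)) - \<beta> * (v \<bullet> (B *v v))"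
    unfolding A_path_vector C_vector inner_diff_right inner_add_right inner_scaleR_right iv
    using hermitian_inner_i[OF herm_\<Omega>, of v]
    by (simp add: xuv Pu Pv Bu matrix_vector_right_distrib inner_add_right algebra_simps)
  ultimately have "\<beta> * (v \<bullet> (B *v v)) = t * ((\<i> *s v) \<bullet> (\<Omega> *v u)) + (- Im \<zeta>) * (norm v)\<^sup>2"
    using x by simp
  moreover have "t * ((\<i> *s v) \<bullet> (\<Omega> *v u)) \<le> \<omega> * norm u * norm v"
  proof -
    have "t * ((\<i> *s v) \<bullet> (\<Omega> *v u)) \<le> t * \<bar>(\<i> *s v) \<bullet> (\<Omega> *v u)\<bar>"
      using t by (intro mult_left_mono) auto
    also have "\<dots> \<le> 1 * (norm (\<i> *s v) * norm (\<Omega> *v u))"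
      using t by (intro mult_mono Cauchy_Schwarz_ineq2) auto
    also have "\<dots> \<le> norm v * (\<omega> * norm u)"
      using norm_\<Omega>[of u] by (simp add: norm_complex_scale mult_left_mono)
    finally show ?thesis by (simp add: mult_ac)
  qed
  moreover have "(- Im \<zeta>) * (norm v)\<^sup>2 \<le> (b * \<beta> / 2 + \<omega>) * (norm v)\<^sup>2"
    using \<zeta>(2) by (intro mult_right_mono) auto
  moreover have "\<beta> * (b * (norm v)\<^sup>2) \<le> \<beta> * (v \<bullet> (B *v v))"
    using \<beta>_pos by (intro mult_left_mono b_le Pv) simp
  ultimately have "\<beta> * (b * (norm v)\<^sup>2) \<le> \<omega> * norm u * norm v + (b * \<beta> / 2 + \<omega>) * (norm v)\<^sup>2"
    by linarith
  then have 2: "((b * \<beta> - 2 * \<omega>) / 2 * norm v) * norm v \<le> (\<omega> * norm u) * norm v"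
    by (simp add: algebra_simps power2_eq_square)
  \<comment> \<open>\<open>k\<close> is \<open>b * \<beta>\<close> minus the threshold
    \<open>b * \<beta> / 2 + \<omega>\<close> for \<open>- Im \<zeta>\<close>; the threshold is
    placed so that \<open>\<omega>\<^sup>2 / k\<close> is exactly \<open>c\<close>.\<close>
  define k where "k = (b * \<beta> - 2 * \<omega>) / 2"
  have k: "k > 0" using \<beta>_gap by (simp add: k_def)
  have vu: "k * norm v \<le> \<omega> * norm u"
  proof (cases "v = 0")
    case False
    then show ?thesis using 2 by (simp add: k_def)
  qed (use \<omega>_pos in simp)
  have "u \<noteq> 0"
  proof
    assume "u = 0"
    then have "v = 0" using vu k by (simp add: mult_le_0_iff)
    then show False using \<open>u = 0\<close> x xuv by simp
  qed
  obtain r where r: "r \<in> real_spec C"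
    "cmod (\<zeta> - complex_of_real r) * norm u \<le> norm (\<zeta> *s u - C *v u)"
    using hermitian_spec_dist[OF herm_C] by blast
  \<comment> \<open>The two estimates between \<open>norm u\<close> and \<open>norm v\<close> are
    chained, and \<open>norm u\<close>, which is positive, cancels.\<close>
  have "k * cmod (\<zeta> - complex_of_real r) * norm u \<le> k * (\<omega> * norm v)"
    using r 1 k by (simp add: mult.assoc)
  also have "\<dots> \<le> \<omega> * (\<omega> * norm u)"
    using vu \<omega>_pos by (simp add: mult.left_commute)
  finally have "(k * cmod (\<zeta> - complex_of_real r)) * norm u \<le> \<omega>\<^sup>2 * norm u"
    by (simp add: power2_eq_square mult_ac)
  then have "k * cmod (\<zeta> - complex_of_real r) \<le> \<omega>\<^sup>2" using \<open>u \<noteq> 0\<close> by simp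
  moreover have "c = \<omega>\<^sup>2 / k" by (simp add: c_eq k_def)
  ultimately have "cmod (\<zeta> - complex_of_real r) \<le> c" using k by (simp add: pos_le_divide_eq mult.commute)
  then show thesis using that r by blast
qed


section \<open>Separation of the discs and the two low-loss spectra\<close>

lemma spec_C: "\<zeta> \<in> spec C \<Longrightarrow> \<exists>r\<in>real_spec C. \<zeta> = complex_of_real r"
  using hermitian_spec_real[OF herm_C] by metis

text \<open>Dissipativity: pairing the eigenvalue equation with \<open>\<i> *s x\<close> leaves only
  the term of \<open>B\<close>, with the factor \<open>- \<beta>\<close>.\<close>

lemma Im_spec_A: "\<zeta> \<in> spec (A_matrix \<Omega> B \<beta>) \<Longrightarrow> Im \<zeta> \<le> 0"
proof -
  assume "\<zeta> \<in> spec (A_matrix \<Omega> B \<beta>)"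
  then obtain x where x: "x \<noteq> 0" "A_matrix \<Omega> B \<beta> *v x = \<zeta> *s x" by (auto simp: spec_iff)
  have "Im \<zeta> * (x \<bullet> x) = (\<i> *s x) \<bullet> (\<zeta> *s x)"
    by (simp add: complex_scale_eq[of \<zeta>] inner_add_right)
  also have "\<dots> = - \<beta> * (x \<bullet> (B *v x))"
    using hermitian_inner_i[OF herm_\<Omega>, of x]
    by (simp add: A_matrix_vector inner_diff_right flip: x(2))
  also have "\<dots> \<le> 0" using B_pos \<beta>_pos by simp
  finally show "Im \<zeta> \<le> 0" using x(1) by (metis inner_gt_zero_iff mult_le_0_iff not_less)
qed

abbreviation discs :: "complex set" where
  "discs \<equiv> (\<Union>r\<in>spec C - {0}. {\<zeta>. cmod (\<zeta> - r) \<le> c})"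

lemma discs_bounds:
  assumes "\<zeta> \<in> discs"
  shows "- Im \<zeta> \<le> c" "\<rho> - c \<le> \<bar>Re \<zeta>\<bar>"
proof -
  obtain r where r: "r \<in> real_spec C" "r \<noteq> 0" "cmod (\<zeta> - complex_of_real r) \<le> c"
    using assms spec_C by force
  have "\<bar>Im \<zeta>\<bar> \<le> c" "\<bar>Re \<zeta> - r\<bar> \<le> c"
    using r(3) abs_Im_le_cmod[of "\<zeta> - complex_of_real r"] abs_Re_le_cmod[of "\<zeta> - complex_of_real r"]
    by simp_all
  then show "- Im \<zeta> \<le> c" "\<rho> - c \<le> \<bar>Re \<zeta>\<bar>" using \<rho>_le[OF r(1,2)] by linarith+
qed

text \<open>Ensures that every eigenvalue with \<open>- Im \<zeta> \<le> c\<close> falls under the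
  localization.\<close>

lemma c_le_gap: "c \<le> b * \<beta> / 2 + \<omega>"
  using c_less \<rho>_le_\<omega> \<omega>_pos \<beta>_gap by linarith

lemma A_path_dichotomy:
  assumes "t \<in> {0..1}" "\<zeta> \<in> spec (A_path t)" "- Im \<zeta> \<le> b * \<beta> / 2 + \<omega>"
  shows "cmod \<zeta> \<le> c \<or> \<zeta> \<in> discs"
proof -
  obtain r where r: "r \<in> real_spec C" "cmod (\<zeta> - complex_of_real r) \<le> c"
    using localization[OF assms] by blast
  show ?thesis
  proof (cases "r = 0")
    case False
    then have "complex_of_real r \<in> spec C - {0}" using r(1) by (simp add: real_spec_def)
    then show ?thesis using r(2) by blast
  qed (use r in simp)
qed

lemma spec_H_ll0: "spec_on (A_matrix \<Omega> B \<beta>) (H_ll0 \<Omega> B \<beta>) =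
    {\<zeta> \<in> spec (A_matrix \<Omega> B \<beta>). 0 \<le> - Im \<zeta> \<and> - Im \<zeta> \<le> c \<and> \<bar>Re \<zeta>\<bar> \<le> c}"
  unfolding H_ll0_def spec_on_sum_gen_eigenspaces
proof (intro equalityI subsetI)
  fix \<zeta> assume "\<zeta> \<in> spec (A_matrix \<Omega> B \<beta>) \<inter> {\<zeta>. cmod \<zeta> \<le> c}"
  then show "\<zeta> \<in> {\<zeta> \<in> spec (A_matrix \<Omega> B \<beta>). 0 \<le> - Im \<zeta> \<and> - Im \<zeta> \<le> c \<and> \<bar>Re \<zeta>\<bar> \<le> c}"
    using Im_spec_A abs_Im_le_cmod[of \<zeta>] abs_Re_le_cmod[of \<zeta>] by auto
next
  fix \<zeta> assume \<zeta>: "\<zeta> \<in> {\<zeta> \<in> spec (A_matrix \<Omega> B \<beta>). 0 \<le> - Im \<zeta> \<and> - Im \<zeta> \<le> c \<and> \<bar>Re \<zeta>\<bar> \<le> c}"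
  \<comment> \<open>Here \<open>\<bar>Re \<zeta>\<bar> \<le> c < \<rho> - c\<close>, so the
    dichotomy leaves only the disc about 0.\<close>
  then have "\<zeta> \<notin> discs" using discs_bounds(2)[of \<zeta>] c_less by fastforce
  then show "\<zeta> \<in> spec (A_matrix \<Omega> B \<beta>) \<inter> {\<zeta>. cmod \<zeta> \<le> c}"
    using A_path_dichotomy[of 1 \<zeta>] \<zeta> c_le_gap by (auto simp: A_path_1)
qed

lemma spec_H_ll1: "spec_on (A_matrix \<Omega> B \<beta>) (H_ll1 \<Omega> B \<beta>) =
    {\<zeta> \<in> spec (A_matrix \<Omega> B \<beta>). 0 \<le> - Im \<zeta> \<and> - Im \<zeta> \<le> c \<and> \<rho> - c \<le> \<bar>Re \<zeta>\<bar>}"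
  unfolding H_ll1_def spec_on_sum_gen_eigenspaces
proof (intro equalityI subsetI)
  fix \<zeta> assume \<zeta>: "\<zeta> \<in> spec (A_matrix \<Omega> B \<beta>) \<inter> discs"
  then have "- Im \<zeta> \<le> c" "\<rho> - c \<le> \<bar>Re \<zeta>\<bar>" using discs_bounds[of \<zeta>] by blast+
  then show "\<zeta> \<in> {\<zeta> \<in> spec (A_matrix \<Omega> B \<beta>). 0 \<le> - Im \<zeta> \<and> - Im \<zeta> \<le> c \<and> \<rho> - c \<le> \<bar>Re \<zeta>\<bar>}"
    using \<zeta> Im_spec_A[of \<zeta>] by simp
next
  fix \<zeta> assume \<zeta>: "\<zeta> \<in> {\<zeta> \<in> spec (A_matrix \<Omega> B \<beta>). 0 \<le> - Im \<zeta> \<and> - Im \<zeta> \<le> c \<and> \<rho> - c \<le> \<bar>Re \<zeta>\<bar>}"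
  then have "\<not> cmod \<zeta> \<le> c" using abs_Re_le_cmod[of \<zeta>] c_less by auto
  then show "\<zeta> \<in> spec (A_matrix \<Omega> B \<beta>) \<inter> discs"
    using A_path_dichotomy[of 1 \<zeta>] \<zeta> c_le_gap by (auto simp: A_path_1)
qed

text \<open>Makes the minimum of the quality factors meaningful. The eigenvalue \<rho> of the
  decoupled operator is followed along \<open>A_path\<close>.\<close>

lemma spec_H_ll1_nonempty: "spec_on (A_matrix \<Omega> B \<beta>) (H_ll1 \<Omega> B \<beta>) \<noteq> {}"
proof -
  \<comment> \<open>An open neighbourhood of the discs on which the localization applies and which
    misses the disc about 0; spectrum of the path inside \<open>S\<close> is therefore confined to
    the discs.\<close>
  define S where "S = {\<zeta>. - Im \<zeta> < b * \<beta> / 2 + \<omega>} \<inter> {\<zeta>. c < \<bar>Re \<zeta>\<bar>}"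
  have "spec (A_path 1) \<inter> discs \<noteq> {}"
  proof (rule eigenvalue_persists)
    show "continuous_on {0..1} A_path"
      unfolding A_path_def A_matrix_def by (intro continuous_intros)
    have "discs = (\<Union>r\<in>spec C - {0}. cball r c)"
      by (simp add: cball_def dist_norm norm_minus_commute)
    then show "compact discs" using finite_spec[of C] by (auto intro!: compact_UN)
    show "discs \<subseteq> S"
    proof
      fix \<zeta> assume "\<zeta> \<in> discs"
      from discs_bounds[OF this] show "\<zeta> \<in> S"
        using c_less \<rho>_le_\<omega> \<omega>_pos \<beta>_gap by (simp add: S_def)
    qed
    show "open S"
      unfolding S_def by (intro open_Int open_Collect_less continuous_intros)
    show "spec (A_path t) \<inter> S \<subseteq> discs" if t: "t \<in> {0..1}" for t
    proof
      fix \<zeta> assume \<zeta>: "\<zeta> \<in> spec (A_path t) \<inter> S"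
      then have "\<not> cmod \<zeta> \<le> c" using abs_Re_le_cmod[of \<zeta>] by (auto simp: S_def)
      then show "\<zeta> \<in> discs" using A_path_dichotomy[OF t, of \<zeta>] \<zeta> by (auto simp: S_def)
    qed
    obtain x where x: "x \<noteq> 0" "C *v x = \<rho> *\<^sub>R x" using \<rho>(1) by (auto simp: real_spec_iff)
    \<comment> \<open>An eigenvector of \<open>C\<close> for a nonzero eigenvalue lies in the range
      of \<open>P\<close>, that is in \<open>Ker B\<close>, where \<open>A_path 0\<close> acts as
      \<open>C\<close>.\<close>
    have "P *v (\<rho> *\<^sub>R x) = \<rho> *\<^sub>R x"
      unfolding x(2)[symmetric] C_vector by (rule PP)
    then have Px: "P *v x = x" using \<rho>(2) by (simp add: complex_matrix_scaleR)
    have "B *v x = 0" using BP[of x] by (simp add: Px)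
    then have "A_path 0 *v x = \<rho> *\<^sub>R x"
      unfolding A_path_vector x(2)[symmetric] C_vector Px by simp
    then have "complex_of_real \<rho> \<in> spec (A_path 0)"
      using x(1) by (auto simp: spec_iff scaleR_eq_complex_scale)
    moreover have "complex_of_real \<rho> \<in> S"
      using \<rho>(2) c_less \<beta>_gap \<omega>_pos by (simp add: S_def)
    ultimately show "spec (A_path 0) \<inter> S \<noteq> {}" by blast
  qed
  then show ?thesis by (simp add: H_ll1_def spec_on_sum_gen_eigenspaces A_path_1)
qed

lemma quality_factor_ge:
  assumes "\<zeta> \<in> spec_on (A_matrix \<Omega> B \<beta>) (H_ll1 \<Omega> B \<beta>)"
  shows "ereal (1 / 2 * ((\<rho> - c) / c)) \<le> quality_factor \<zeta>"
proof -
  have \<zeta>: "0 \<le> - Im \<zeta>" "- Im \<zeta> \<le> c" "\<rho> - c \<le> \<bar>Re \<zeta>\<bar>" using assms by (auto simp: spec_H_ll1)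
  then have "\<zeta> \<noteq> 0" using c_less c_pos by auto
  \<comment> \<open>On the real axis the factor of a nonzero \<zeta> is infinite by definition, so
    the quotient is compared only off it.\<close>
  moreover have "1 / 2 * ((\<rho> - c) / c) \<le> 1 / 2 * (\<bar>Re \<zeta>\<bar> / (- Im \<zeta>))" if "Im \<zeta> \<noteq> 0"
    using \<zeta> that by (intro mult_left_mono frac_le) auto
  ultimately show ?thesis by (simp add: quality_factor_def)
qed

section \<open>Monotonicity and limit of \<open>c\<close>\<close>

lemma strict_antimono_c_fun: "strict_antimono_on {2 * \<omega> / b <..} (c_fun \<Omega> B)"
proof (rule monotone_onI)
  fix x y assume xy: "x \<in> {2 * \<omega> / b <..}" "y \<in> {2 * \<omega> / b <..}" "x < y"
  have "0 < 2 * \<omega>\<^sup>2 / b" using \<omega>_pos b(2) by simp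
  moreover have "inverse (y - 2 * \<omega> / b) < inverse (x - 2 * \<omega> / b)"
    using xy by (intro less_imp_inverse_less) auto
  ultimately show "c_fun \<Omega> B x > c_fun \<Omega> B y"
    unfolding c_fun_def by (rule mult_strict_left_mono[rotated])
qed

lemma c_fun_tendsto: "(c_fun \<Omega> B \<longlongrightarrow> 0) at_top"
proof -
  have "filterlim (\<lambda>x. - (2 * \<omega> / b) + x) at_top at_top"
    by (rule filterlim_tendsto_add_at_top[OF tendsto_const filterlim_ident])
  then have "filterlim (\<lambda>x. x - 2 * \<omega> / b) at_top at_top"
    by (simp add: algebra_simps)
  then have "((\<lambda>x. 2 * \<omega>\<^sup>2 / b * inverse (x - 2 * \<omega> / b)) \<longlongrightarrow> 2 * \<omega>\<^sup>2 / b * 0) at_top"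
    by (intro tendsto_mult_left tendsto_inverse_0_at_top)
  then show ?thesis by (simp add: c_fun_def[abs_def])
qed

end

section \<open>The system operator\<close>

lemma transpose_congruence:
  fixes S T :: "real^'n^'n"
  assumes "transpose S = S"
  shows "transpose (S ** T ** S) = S ** transpose T ** S"
  by (simp add: matrix_transpose_mul assms matrix_mul_assoc)

lemma transpose_entry: "transpose M = N \<Longrightarrow> M $ j $ i = N $ i $ j"
  by (auto simp: transpose_def)

lemma matrix_minus_mult: "(- A :: real^'n^'m) ** M = - (A ** M)" "M' ** (- A) = - (M' ** A)"
  by (simp_all add: matrix_matrix_mult_def vec_eq_iff sum_negf)

text \<open>Congruence with the symmetric inverse root keeps \<theta> skew, so \<open>\<i>\<close>
  times it is Hermitian. Every entry is \<open>\<i>\<close> times a real number, hence the sign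
  change under conjugation.\<close>

lemma Omega_matrix_entries:
  assumes \<theta>: "transpose \<theta> = - \<theta>" and \<alpha>: "transpose \<alpha> = \<alpha>" "pos_def \<alpha>"
  shows "Omega_matrix \<alpha> \<eta> \<theta> $ i $ j = cnj (Omega_matrix \<alpha> \<eta> \<theta> $ j $ i)"
    and "cnj (Omega_matrix \<alpha> \<eta> \<theta> $ i $ j) = - Omega_matrix \<alpha> \<eta> \<theta> $ i $ j"
proof -
  define S where "S = matrix_inv (msqrt \<alpha>)"
  have S: "transpose S = S"
    unfolding S_def by (intro transpose_matrix_inv msqrt_pos_def invertible_msqrt \<alpha>)
  have "transpose (S ** \<theta> ** S) = - (S ** \<theta> ** S)"
    by (simp add: transpose_congruence S \<theta> matrix_minus_mult)
  then have skew: "(S ** \<theta> ** S) $ l $ k = - ((S ** \<theta> ** S) $ k $ l)" for k l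
    by (rule transpose_entry[THEN trans]) simp
  have entries:
    "Omega_matrix \<alpha> \<eta> \<theta> $ Inl k $ Inl l = - 2 * \<i> * complex_of_real ((S ** \<theta> ** S) $ k $ l)"
    "Omega_matrix \<alpha> \<eta> \<theta> $ Inl k $ Inr l = - \<i> * complex_of_real (Phi_matrix \<alpha> \<eta> $ l $ k)"
    "Omega_matrix \<alpha> \<eta> \<theta> $ Inr k $ Inl l = \<i> * complex_of_real (Phi_matrix \<alpha> \<eta> $ k $ l)"
    "Omega_matrix \<alpha> \<eta> \<theta> $ Inr k $ Inr l = 0" for k l
    by (simp_all add: Omega_matrix_def block_matrix_def cmult_def complexify_def map_matrix_def
        transpose_def S_def)
  show "Omega_matrix \<alpha> \<eta> \<theta> $ i $ j = cnj (Omega_matrix \<alpha> \<eta> \<theta> $ j $ i)"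
  proof (cases i; cases j)
    fix k l assume ij: "i = Inl k" "j = Inl l"
    show ?thesis unfolding ij entries skew[of l k] by simp
  qed (simp_all add: entries)
  show "cnj (Omega_matrix \<alpha> \<eta> \<theta> $ i $ j) = - Omega_matrix \<alpha> \<eta> \<theta> $ i $ j"
    by (cases i; cases j) (simp_all add: entries)
qed

lemma B_matrix_nth:
  "B_matrix \<alpha> R $ Inl k $ Inl l =
    complex_of_real ((matrix_inv (msqrt \<alpha>) ** R ** matrix_inv (msqrt \<alpha>)) $ k $ l)"
  "B_matrix \<alpha> R $ Inl k $ Inr m = 0" "B_matrix \<alpha> R $ Inr m $ j = 0"
  by (simp_all add: B_matrix_def block_matrix_def complexify_def map_matrix_def split: sum.split)

lemma B_matrix_entries:
  assumes R: "transpose R = R" and \<alpha>: "transpose \<alpha> = \<alpha>" "pos_def \<alpha>"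
  shows "B_matrix \<alpha> R $ i $ j = cnj (B_matrix \<alpha> R $ j $ i)"
    and "cnj (B_matrix \<alpha> R $ i $ j) = B_matrix \<alpha> R $ i $ j"
proof -
  define S where "S = matrix_inv (msqrt \<alpha>)"
  have S: "transpose S = S"
    unfolding S_def by (intro transpose_matrix_inv msqrt_pos_def invertible_msqrt \<alpha>)
  have "transpose (S ** R ** S) = S ** R ** S"
    by (simp add: transpose_congruence S R)
  from transpose_entry[OF this] have symm: "(S ** R ** S) $ l $ k = (S ** R ** S) $ k $ l" for k l
    by simp
  show "B_matrix \<alpha> R $ i $ j = cnj (B_matrix \<alpha> R $ j $ i)"
  proof (cases i; cases j)
    fix k l assume ij: "i = Inl k" "j = Inl l"
    show ?thesis unfolding ij B_matrix_nth S_def[symmetric] symm[of l k] by simp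
  qed (simp_all add: B_matrix_nth)
  show "cnj (B_matrix \<alpha> R $ i $ j) = B_matrix \<alpha> R $ i $ j"
    by (cases i; cases j) (simp_all add: B_matrix_nth)
qed

lemma sum_UNIV_Plus:
  fixes f :: "'a::finite + 'b::finite \<Rightarrow> 'c::comm_monoid_add"
  shows "sum f UNIV = (\<Sum>i\<in>UNIV. f (Inl i)) + (\<Sum>i\<in>UNIV. f (Inr i))"
  by (simp add: sum.Plus flip: UNIV_Plus_UNIV)

text \<open>\<open>B\<close> is real and acts on the first summand only, so its form is the sum of
  the real form at the real and imaginary parts of the first component; each is a value of the form
  of \<open>R\<close>.\<close>

lemma B_matrix_nonneg:
  assumes R: "pos_semidef R" and \<alpha>: "transpose \<alpha> = \<alpha>" "pos_def \<alpha>"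
  shows "0 \<le> x \<bullet> (B_matrix \<alpha> R *v x)"
proof -
  define S where "S = matrix_inv (msqrt \<alpha>)"
  have S: "transpose S = S"
    unfolding S_def by (intro transpose_matrix_inv msqrt_pos_def invertible_msqrt \<alpha>)
  have pos: "0 \<le> y \<bullet> ((S ** R ** S) *v y)" for y
  proof -
    have "y \<bullet> ((S ** R ** S) *v y) = (S *v y) \<bullet> (R *v (S *v y))"
      using S by (simp add: self_adjoint_def flip: matrix_vector_mul_assoc self_adjoint_symmetric_matrix)
    then show ?thesis using R by (simp add: pos_semidef_def)
  qed
  define p q :: "real^'a" where "p = (\<chi> i. Re (x $ Inl i))" and "q = (\<chi> i. Im (x $ Inl i))"
  have "x \<bullet> (B_matrix \<alpha> R *v x) = p \<bullet> ((S ** R ** S) *v p) + q \<bullet> ((S ** R ** S) *v q)"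
    unfolding S_def
    by (simp add: inner_vec_def inner_complex_def matrix_vector_mult_def sum_UNIV_Plus B_matrix_nth
        p_def q_def sum.distrib)
  then show ?thesis using pos by simp
qed

text \<open>The congruence with the inverse root is undone by multiplying with the root on both
  sides.\<close>

lemma B_matrix_nonzero:
  assumes \<alpha>: "transpose \<alpha> = \<alpha>" "pos_def \<alpha>" and R: "R \<noteq> 0"
  shows "B_matrix \<alpha> R \<noteq> 0"
proof
  let ?T = "msqrt \<alpha>"
  assume "B_matrix \<alpha> R = 0"
  then have "B_matrix \<alpha> R $ Inl i $ Inl j = 0" for i j by simp
  then have Y: "matrix_inv ?T ** R ** matrix_inv ?T = 0"
    by (simp add: B_matrix_def block_matrix_def complexify_def map_matrix_def vec_eq_iff)
  have inv: "?T ** matrix_inv ?T = mat 1" "matrix_inv ?T ** ?T = mat 1"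
    using matrix_inv_inverse[OF invertible_msqrt[OF \<alpha>]] by auto
  have "R = (?T ** matrix_inv ?T) ** R ** (matrix_inv ?T ** ?T)" by (simp add: inv)
  also have "\<dots> = ?T ** (matrix_inv ?T ** R ** matrix_inv ?T) ** ?T"
    by (simp add: matrix_mul_assoc)
  also have "\<dots> = 0" by (simp add: Y)
  finally show False using R by simp
qed

theorem corollary34:
  fixes \<alpha> \<eta> \<theta> R :: "real^'n^'n"
    and \<Omega> B :: "complex^('n + 'n)^('n + 'n)"
    and \<beta> :: real
  assumes "transpose \<alpha> = \<alpha>" "pos_def \<alpha>"
    and "transpose \<eta> = \<eta>" "pos_semidef \<eta>"
    and "transpose \<theta> = - \<theta>"
    and "transpose R = R" "pos_semidef R"
    and "0 < rank R" "rank R < CARD('n)"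
    and "\<Omega> = Omega_matrix \<alpha> \<eta> \<theta>" "B = B_matrix \<alpha> R"
    and "compressed_Omega \<Omega> B \<noteq> 0"
    and "0 \<le> \<beta>" "c_inv \<Omega> B (rho_min \<Omega> B / 2) < \<beta>"
  shows
    "spec_on (A_matrix \<Omega> B \<beta>) (H_ll0 \<Omega> B \<beta>) =
       {\<zeta> \<in> spec (A_matrix \<Omega> B \<beta>).
          0 \<le> - Im \<zeta> \<and> - Im \<zeta> \<le> c_fun \<Omega> B \<beta> \<and> \<bar>Re \<zeta>\<bar> \<le> c_fun \<Omega> B \<beta>} \<and>
     spec_on (A_matrix \<Omega> B \<beta>) (H_ll1 \<Omega> B \<beta>) =
       {\<zeta> \<in> spec (A_matrix \<Omega> B \<beta>).
          0 \<le> - Im \<zeta> \<and> - Im \<zeta> \<le> c_fun \<Omega> B \<beta> \<and>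
          rho_min \<Omega> B - c_fun \<Omega> B \<beta> \<le> \<bar>Re \<zeta>\<bar>} \<and>
     max (c_fun \<Omega> B \<beta>) (rho_min \<Omega> B / 2) < rho_min \<Omega> B - c_fun \<Omega> B \<beta> \<and>
     rho_min \<Omega> B / 2 \<le> omega_max \<Omega> / 2 \<and>
     strict_antimono_on {2 * omega_max \<Omega> / b_min B <..} (c_fun \<Omega> B) \<and>
     (c_fun \<Omega> B \<longlongrightarrow> 0) at_top \<and>
     spec_on (A_matrix \<Omega> B \<beta>) (H_ll1 \<Omega> B \<beta>) \<noteq> {} \<and>
     ereal (1 / 2 * ((rho_min \<Omega> B - c_fun \<Omega> B \<beta>) / c_fun \<Omega> B \<beta>))
       \<le> Min (quality_factor ` spec_on (A_matrix \<Omega> B \<beta>) (H_ll1 \<Omega> B \<beta>)) \<and>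
     1 / 4 * (rho_min \<Omega> B / c_fun \<Omega> B \<beta>)
       < 1 / 2 * ((rho_min \<Omega> B - c_fun \<Omega> B \<beta>) / c_fun \<Omega> B \<beta>) \<and>
     1 / 2 \<le> 1 / 4 * (rho_min \<Omega> B / c_fun \<Omega> B \<beta>) \<and>
     (\<forall>\<zeta> \<in> spec_on (A_matrix \<Omega> B \<beta>) (H_ll1 \<Omega> B \<beta>). Re \<zeta> \<noteq> 0)"
proof -
  have \<alpha>: "transpose \<alpha> = \<alpha>" "pos_def \<alpha>" by fact+
  have "R \<noteq> 0" using \<open>0 < rank R\<close> by auto
  interpret high_loss \<Omega> B \<beta>
  proof
    show "self_adjoint ((*v) \<Omega>)" "self_adjoint ((*v) B)"
      unfolding \<open>\<Omega> = _\<close> \<open>B = _\<close>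
      by (intro self_adjoint_complex_matrixI Omega_matrix_entries(1) B_matrix_entries(1) \<alpha>; fact)+
    show "0 \<le> x \<bullet> (B *v x)" for x
      unfolding \<open>B = _\<close> by (rule B_matrix_nonneg[OF \<open>pos_semidef R\<close> \<alpha>])
    show "\<Omega> *v cnjv x = - cnjv (\<Omega> *v x)" for x
      using Omega_matrix_entries(2)[OF \<open>transpose \<theta> = - \<theta>\<close> \<alpha>, of \<eta>]
      by (simp add: \<open>\<Omega> = _\<close> cnjv_def matrix_vector_mult_def vec_eq_iff flip: sum_negf)
    show "B *v cnjv x = cnjv (B *v x)" for x
      using B_matrix_entries(2)[OF \<open>transpose R = R\<close> \<alpha>]
      by (simp add: \<open>B = _\<close> cnjv_def matrix_vector_mult_def vec_eq_iff)
    show "B \<noteq> 0" unfolding \<open>B = _\<close> by (rule B_matrix_nonzero[OF \<alpha> \<open>R \<noteq> 0\<close>])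
  qed fact+
  let ?H1 = "spec_on (A_matrix \<Omega> B \<beta>) (H_ll1 \<Omega> B \<beta>)"
  \<comment> \<open>Finiteness, together with nonemptiness, makes \<open>Min\<close> a true minimum,
    so a bound on each quality factor suffices.\<close>
  have fin: "finite ?H1"
    unfolding H_ll1_def spec_on_sum_gen_eigenspaces using finite_spec by blast
  have "max c (\<rho> / 2) < \<rho> - c" using c_less by simp
  moreover have "ereal (1 / 2 * ((\<rho> - c) / c)) \<le> Min (quality_factor ` ?H1)"
    using fin spec_H_ll1_nonempty quality_factor_ge by simp
  moreover have "1 / 4 * (\<rho> / c) < 1 / 2 * ((\<rho> - c) / c)" "1 / 2 \<le> 1 / 4 * (\<rho> / c)"
    using c_less c_pos by (simp_all add: field_simps)
  moreover have "\<forall>\<zeta> \<in> ?H1. Re \<zeta> \<noteq> 0"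
    using c_less c_pos by (auto simp: spec_H_ll1)
  ultimately show ?thesis
    using spec_H_ll0 spec_H_ll1 \<rho>_le_\<omega> strict_antimono_c_fun c_fun_tendsto spec_H_ll1_nonempty
    by (intro conjI) auto
qed

end
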